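(* Let $\theta\in\mathbb N$, $I=\{1,2,\dots,\theta\}$, $A=\{x,y\}$ with $x\neq y$, let $\mathcal C=\mathcal C(I,A,(\rho_i)_{i\in I},(C^a)_{a\in A})$ be a connected Cartan scheme and $\mathcal R=\mathcal R(\mathcal C,(R^a)_{a\in A})$ a root system of type $\mathcal C$. Let $\kappa\in I$ be such that $\rho_i(x)=y$, $\rho_i(y)=x$ for $1\le i\le\kappa$ and $\rho_i(x)=x$, $\rho_i(y)=y$ for $\kappa<i\le\theta$. If $\mathcal R$ is finite and irreducible, then, up to permutation of $\{x,y\}$ and of $I$, one of the following holds: (1) $\kappa\in\{1,\dots,\theta\}$ is arbitrary, and $C^x=C^y$ is an indecomposable Cartan matrix of finite type such that $c^x_{ij}c^x_{ji}\neq 1$ for all $i,j$ with $i\le\kappa<j$; (2) $\theta=2$, $\kappa=1$, $c^x_{12}=c^y_{12}=-1$, $c^x_{21}=-3$, $c^y_{21}\in\{-4,-5\}$; (3) $\theta=3$, $\kappa=1$, $C^x=\begin{pmatrix}2&-1&0\\-2&2&-1\\0&-1&2\end{pmatrix}$, $C^y=\begin{pmatrix}2&-1&0\\-2&2&-2\\0&-1&2\end{pmatrix}$; (4) $\theta=3$, $\kappa=1$, $C^x=\begin{pmatrix}2&-2&0\\-1&2&-1\\0&-1&2\end{pmatrix}$, $C^y=\begin{pmatrix}2&-2&0\\-1&2&-2\\0&-1&2\end{pmatrix}$. Conversely, if $C^x,C^y$ satisfy one of the conditions (1)–(4), then $\mathcal R$ is finite and irreducible.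
   Context: Let $I$ be a nonempty finite set and $\{\alpha_i\mid i\in I\}$ the standard basis of $\mathbb Z^I$; $\mathbb N=\{1,2,\dots\}$, $\mathbb N_0=\mathbb N\cup\{0\}$. A generalized Cartan matrix is $C=(c_{ij})_{i,j\in I}\in\mathbb Z^{I\times I}$ with $c_{ii}=2$, $c_{jk}\le0$ for $j\ne k$, and $c_{ij}=0\Rightarrow c_{ji}=0$. A Cartan scheme $\mathcal C=\mathcal C(I,A,(\rho_i)_{i\in I},(C^a)_{a\in A})$ consists of a nonempty set $A$, maps $\rho_i:A\to A$ and generalized Cartan matrices $C^a=(c^a_{jk})_{j,k\in I}$ ($a\in A$) such that (C1) $\rho_i^2=\mathrm{id}$ and (C2) $c^a_{ij}=c^{\rho_i(a)}_{ij}$ for all $a\in A$, $i,j\in I$. It is connected if the group generated by the $\rho_i$ acts transitively on $A$. For $i\in I$, $a\in A$ let $\sigma_i^a\in\mathrm{Aut}(\mathbb Z^I)$, $\sigma_i^a(\alpha_j)=\alpha_j-c^a_{ij}\alpha_i$. A root system of type $\mathcal C$ is a family $\mathcal R=\mathcal R(\mathcal C,(R^a)_{a\in A})$ of subsets $R^a\subset\mathbb Z^I$ such that, writing $R^a_+=R^a\cap\mathbb N_0^I$ and $m^a_{i,j}=|R^a\cap(\mathbb N_0\alpha_i+\mathbb N_0\alpha_j)|$, for all $a\in A$, $i,j\in I$: (R1) $R^a=R^a_+\cup(-R^a_+)$; (R2) $R^a\cap\mathbb Z\alpha_i=\{\alpha_i,-\alpha_i\}$; (R3) $\sigma_i^a(R^a)=R^{\rho_i(a)}$;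 (R4) if $i\neq j$ and $m^a_{i,j}$ is finite then $(\rho_i\rho_j)^{m^a_{i,j}}(a)=a$. It is finite if every $R^a$ is finite. $\mathcal R$ is reducible if there exist nonempty disjoint $I_1,I_2\subset I$ with $I=I_1\cup I_2$ and $R^a=(R^a\cap\sum_{i\in I_1}\mathbb Z\alpha_i)\cup(R^a\cap\sum_{j\in I_2}\mathbb Z\alpha_j)$ for all $a\in A$; otherwise it is irreducible. "Cartan matrix of finite type" and "indecomposable" are in the usual sense of Kac–Moody theory. *)

theory Defs
  imports Complex_Main "HOL-Combinatorics.Permutations"
begin

(* Index set I = {1..theta}; vectors of Z^I are functions nat => int vanishing off I.
   Generalized Cartan matrices are functions nat => nat => int (only entries on I x I matter).
   Objects live in a type 'a, the object set is a set A :: 'a set. *)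

definition Iset :: "nat \<Rightarrow> nat set" where
  "Iset \<theta> = {1..\<theta>}"

definition ZI :: "nat \<Rightarrow> (nat \<Rightarrow> int) set" where
  "ZI \<theta> = {v. \<forall>k. k \<notin> Iset \<theta> \<longrightarrow> v k = 0}"

definition alpha :: "nat \<Rightarrow> nat \<Rightarrow> int" where
  "alpha i = (\<lambda>k. if k = i then 1 else 0)"

definition gcm :: "nat \<Rightarrow> (nat \<Rightarrow> nat \<Rightarrow> int) \<Rightarrow> bool" where
  "gcm \<theta> M \<longleftrightarrow>
     (\<forall>i\<in>Iset \<theta>. M i i = 2) \<and>
     (\<forall>j\<in>Iset \<theta>. \<forall>k\<in>Iset \<theta>. j \<noteq> k \<longrightarrow> M j k \<le> 0) \<and>
     (\<forall>i\<in>Iset \<theta>. \<forall>j\<in>Iset \<theta>. M i j = 0 \<longrightarrow> M j i = 0)"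

definition cartan_scheme ::
  "nat \<Rightarrow> 'a set \<Rightarrow> (nat \<Rightarrow> 'a \<Rightarrow> 'a) \<Rightarrow> ('a \<Rightarrow> nat \<Rightarrow> nat \<Rightarrow> int) \<Rightarrow> bool" where
  "cartan_scheme \<theta> A \<rho> C \<longleftrightarrow>
     A \<noteq> {} \<and>
     (\<forall>i\<in>Iset \<theta>. \<forall>a\<in>A. \<rho> i a \<in> A) \<and>
     (\<forall>a\<in>A. gcm \<theta> (C a)) \<and>
     (\<forall>i\<in>Iset \<theta>. \<forall>a\<in>A. \<rho> i (\<rho> i a) = a) \<and>
     (\<forall>a\<in>A. \<forall>i\<in>Iset \<theta>. \<forall>j\<in>Iset \<theta>. C a i j = C (\<rho> i a) i j)"

(* connected: the group generated by the rho_i acts transitively on A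
   (since each rho_i is an involution, reachability by finitely many rho's suffices) *)
definition connected_scheme :: "nat \<Rightarrow> 'a set \<Rightarrow> (nat \<Rightarrow> 'a \<Rightarrow> 'a) \<Rightarrow> bool" where
  "connected_scheme \<theta> A \<rho> \<longleftrightarrow>
     (\<forall>a\<in>A. \<forall>b\<in>A. (a, b) \<in> {(c, \<rho> i c) | c i. c \<in> A \<and> i \<in> Iset \<theta>}\<^sup>*)"

(* sigma_i^a (v) = v - (sum_j c^a_ij v_j) alpha_i, the linear extension of
   sigma_i^a(alpha_j) = alpha_j - c^a_ij alpha_i *)
definition sigma :: "nat \<Rightarrow> ('a \<Rightarrow> nat \<Rightarrow> nat \<Rightarrow> int) \<Rightarrow> 'a \<Rightarrow> nat \<Rightarrow> (nat \<Rightarrow> int) \<Rightarrow> (nat \<Rightarrow> int)" where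
  "sigma \<theta> C a i v = (\<lambda>k. v k - (\<Sum>j\<in>Iset \<theta>. C a i j * v j) * alpha i k)"

definition pos_part :: "(nat \<Rightarrow> int) set \<Rightarrow> (nat \<Rightarrow> int) set" where
  "pos_part R = {v \<in> R. \<forall>k. 0 \<le> v k}"

definition rank2_pos :: "nat \<Rightarrow> nat \<Rightarrow> (nat \<Rightarrow> int) set" where
  "rank2_pos i j = {(\<lambda>k. s * alpha i k + t * alpha j k) | s t. 0 \<le> s \<and> 0 \<le> t}"

definition root_system ::
  "nat \<Rightarrow> 'a set \<Rightarrow> (nat \<Rightarrow> 'a \<Rightarrow> 'a) \<Rightarrow> ('a \<Rightarrow> nat \<Rightarrow> nat \<Rightarrow> int)
    \<Rightarrow> ('a \<Rightarrow> (nat \<Rightarrow> int) set) \<Rightarrow> bool" where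
  "root_system \<theta> A \<rho> C R \<longleftrightarrow>
     cartan_scheme \<theta> A \<rho> C \<and>
     (\<forall>a\<in>A. R a \<subseteq> ZI \<theta>) \<and>
     (\<forall>a\<in>A. R a = pos_part (R a) \<union> uminus ` pos_part (R a)) \<and>
     (\<forall>a\<in>A. \<forall>i\<in>Iset \<theta>.
        R a \<inter> range (\<lambda>n::int. (\<lambda>k. n * alpha i k)) = {alpha i, - alpha i}) \<and>
     (\<forall>a\<in>A. \<forall>i\<in>Iset \<theta>. sigma \<theta> C a i ` R a = R (\<rho> i a)) \<and>
     (\<forall>a\<in>A. \<forall>i\<in>Iset \<theta>. \<forall>j\<in>Iset \<theta>. i \<noteq> j \<longrightarrow> finite (R a \<inter> rank2_pos i j) \<longrightarrow>
        ((\<rho> i \<circ> \<rho> j) ^^ card (R a \<inter> rank2_pos i j)) a = a)"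

definition finite_rs :: "'a set \<Rightarrow> ('a \<Rightarrow> (nat \<Rightarrow> int) set) \<Rightarrow> bool" where
  "finite_rs A R \<longleftrightarrow> (\<forall>a\<in>A. finite (R a))"

definition span_sub :: "nat set \<Rightarrow> (nat \<Rightarrow> int) set" where
  "span_sub J = {v. \<forall>k. k \<notin> J \<longrightarrow> v k = 0}"

definition reducible_rs :: "nat \<Rightarrow> 'a set \<Rightarrow> ('a \<Rightarrow> (nat \<Rightarrow> int) set) \<Rightarrow> bool" where
  "reducible_rs \<theta> A R \<longleftrightarrow>
     (\<exists>I1 I2. I1 \<noteq> {} \<and> I2 \<noteq> {} \<and> I1 \<inter> I2 = {} \<and> I1 \<union> I2 = Iset \<theta> \<and>
        (\<forall>a\<in>A. R a = (R a \<inter> span_sub I1) \<union> (R a \<inter> span_sub I2)))"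

definition irreducible_rs :: "nat \<Rightarrow> 'a set \<Rightarrow> ('a \<Rightarrow> (nat \<Rightarrow> int) set) \<Rightarrow> bool" where
  "irreducible_rs \<theta> A R \<longleftrightarrow> \<not> reducible_rs \<theta> A R"

(* Kac-Moody notions for a matrix indexed by I = {1..theta} *)
definition indecomposable :: "nat \<Rightarrow> (nat \<Rightarrow> nat \<Rightarrow> int) \<Rightarrow> bool" where
  "indecomposable \<theta> M \<longleftrightarrow>
     \<not> (\<exists>I1 I2. I1 \<noteq> {} \<and> I2 \<noteq> {} \<and> I1 \<inter> I2 = {} \<and> I1 \<union> I2 = Iset \<theta> \<and>
          (\<forall>i\<in>I1. \<forall>j\<in>I2. M i j = 0 \<and> M j i = 0))"

(* Leibniz determinant over the index set I *)
definition det_I :: "nat \<Rightarrow> (nat \<Rightarrow> nat \<Rightarrow> int) \<Rightarrow> int" where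
  "det_I \<theta> M = (\<Sum>p\<in>{p. p permutes Iset \<theta>}. sign p * (\<Prod>i\<in>Iset \<theta>. M i (p i)))"

definition matvec :: "nat \<Rightarrow> (nat \<Rightarrow> nat \<Rightarrow> int) \<Rightarrow> (nat \<Rightarrow> real) \<Rightarrow> nat \<Rightarrow> real" where
  "matvec \<theta> M u = (\<lambda>i. \<Sum>j\<in>Iset \<theta>. real_of_int (M i j) * u j)"

(* Kac, Thm. 4.3 / definition of type (Fin): det M \<noteq> 0; there is u > 0 with Mu > 0;
   Mv \<ge> 0 implies v > 0 or v = 0  (vector inequalities componentwise on I) *)
definition finite_type :: "nat \<Rightarrow> (nat \<Rightarrow> nat \<Rightarrow> int) \<Rightarrow> bool" where
  "finite_type \<theta> M \<longleftrightarrow>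
     det_I \<theta> M \<noteq> 0 \<and>
     (\<exists>u. (\<forall>i\<in>Iset \<theta>. u i > 0) \<and> (\<forall>i\<in>Iset \<theta>. matvec \<theta> M u i > 0)) \<and>
     (\<forall>v. (\<forall>i\<in>Iset \<theta>. matvec \<theta> M v i \<ge> 0) \<longrightarrow>
          (\<forall>i\<in>Iset \<theta>. v i > 0) \<or> (\<forall>i\<in>Iset \<theta>. v i = 0))"

definition cartan_finite_type :: "nat \<Rightarrow> (nat \<Rightarrow> nat \<Rightarrow> int) \<Rightarrow> bool" where
  "cartan_finite_type \<theta> M \<longleftrightarrow> gcm \<theta> M \<and> finite_type \<theta> M"

(* the four cases, for matrices Cx, Cy (already relabelled) *)
definition case1 :: "nat \<Rightarrow> nat \<Rightarrow> (nat \<Rightarrow> nat \<Rightarrow> int) \<Rightarrow> (nat \<Rightarrow> nat \<Rightarrow> int) \<Rightarrow> bool" where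
  "case1 \<theta> \<kappa> Cx Cy \<longleftrightarrow>
     \<kappa> \<in> Iset \<theta> \<and>
     (\<forall>i\<in>Iset \<theta>. \<forall>j\<in>Iset \<theta>. Cx i j = Cy i j) \<and>
     indecomposable \<theta> Cx \<and> cartan_finite_type \<theta> Cx \<and>
     (\<forall>i\<in>Iset \<theta>. \<forall>j\<in>Iset \<theta>. i \<le> \<kappa> \<and> \<kappa> < j \<longrightarrow> Cx i j * Cx j i \<noteq> 1)"

definition case2 :: "nat \<Rightarrow> nat \<Rightarrow> (nat \<Rightarrow> nat \<Rightarrow> int) \<Rightarrow> (nat \<Rightarrow> nat \<Rightarrow> int) \<Rightarrow> bool" where
  "case2 \<theta> \<kappa> Cx Cy \<longleftrightarrow>
     \<theta> = 2 \<and> \<kappa> = 1 \<and> Cx 1 2 = -1 \<and> Cy 1 2 = -1 \<and> Cx 2 1 = -3 \<and> Cy 2 1 \<in> {-4, -5}"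

definition mat3 :: "int \<Rightarrow> int \<Rightarrow> int \<Rightarrow> int \<Rightarrow> int \<Rightarrow> int \<Rightarrow> int \<Rightarrow> int \<Rightarrow> int
    \<Rightarrow> (nat \<Rightarrow> nat \<Rightarrow> int) \<Rightarrow> bool" where
  "mat3 a11 a12 a13 a21 a22 a23 a31 a32 a33 M \<longleftrightarrow>
     M 1 1 = a11 \<and> M 1 2 = a12 \<and> M 1 3 = a13 \<and>
     M 2 1 = a21 \<and> M 2 2 = a22 \<and> M 2 3 = a23 \<and>
     M 3 1 = a31 \<and> M 3 2 = a32 \<and> M 3 3 = a33"

definition case3 :: "nat \<Rightarrow> nat \<Rightarrow> (nat \<Rightarrow> nat \<Rightarrow> int) \<Rightarrow> (nat \<Rightarrow> nat \<Rightarrow> int) \<Rightarrow> bool" where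
  "case3 \<theta> \<kappa> Cx Cy \<longleftrightarrow>
     \<theta> = 3 \<and> \<kappa> = 1 \<and>
     mat3 2 (-1) 0  (-2) 2 (-1)  0 (-1) 2 Cx \<and>
     mat3 2 (-1) 0  (-2) 2 (-2)  0 (-1) 2 Cy"

definition case4 :: "nat \<Rightarrow> nat \<Rightarrow> (nat \<Rightarrow> nat \<Rightarrow> int) \<Rightarrow> (nat \<Rightarrow> nat \<Rightarrow> int) \<Rightarrow> bool" where
  "case4 \<theta> \<kappa> Cx Cy \<longleftrightarrow>
     \<theta> = 3 \<and> \<kappa> = 1 \<and>
     mat3 2 (-2) 0  (-1) 2 (-1)  0 (-1) 2 Cx \<and>
     mat3 2 (-2) 0  (-1) 2 (-2)  0 (-1) 2 Cy"

(* "up to permutation of {x,y} and of I": a relabelling (x0,y0) of the objects and a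
   permutation pi of I respecting the distinguished block {1..kappa} (so that the relabelled
   scheme again has the prescribed form of the rho_i) such that one of (1)-(4) holds for
   the relabelled matrices. *)
definition classified :: "nat \<Rightarrow> nat \<Rightarrow> 'a \<Rightarrow> 'a \<Rightarrow> ('a \<Rightarrow> nat \<Rightarrow> nat \<Rightarrow> int) \<Rightarrow> bool" where
  "classified \<theta> \<kappa> x y C \<longleftrightarrow>
     (\<exists>\<pi> x0 y0. \<pi> permutes Iset \<theta> \<and> \<pi> ` {1..\<kappa>} = {1..\<kappa>} \<and>
        (x0, y0) \<in> {(x, y), (y, x)} \<and>
        (let Cx = (\<lambda>i j. C x0 (\<pi> i) (\<pi> j)); Cy = (\<lambda>i j. C y0 (\<pi> i) (\<pi> j)) in
          case1 \<theta> \<kappa> Cx Cy \<or> case2 \<theta> \<kappa> Cx Cy \<or> case3 \<theta> \<kappa> Cx Cy \<or> case4 \<theta> \<kappa> Cx Cy))"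

end

theory Submission
  imports Defs "Jordan_Normal_Form.Determinant"
begin

text \<open>Let \<open>P a\<close> be the sum of the positive roots at \<open>a\<close>. Since the i-th reflection permutes the
  positive roots other than \<open>alpha i\<close>, a fixed index \<open>j\<close> satisfies \<open>(C a P a)\<^sub>j = 2\<close>, while for a
  moved index \<open>i\<close> the vectors \<open>P x\<close> and \<open>P y\<close> differ at most in the i-th coordinate. Hence
  at least one of the two Cartan matrices maps a positive vector to a positive vector, so it is of
  finite type, and both are if two indices are moved. The inequalities
  that these row identities impose, together with the observation that no root has coefficients of
  both signs, leave only the listed pairs of matrices.

  Conversely, in case (1) every root is obtained from a simple one, and the roots have bounded
  length for an invariant positive definite form. In the other cases an explicit word of reflections
  maps every simple root to a negative one, which bounds the number of positive roots.\<close>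

section \<open>Finite root systems of Cartan schemes\<close>

text \<open>The obstacle is the case of a single moved index: positive rows are then certain at one
  object only, and the other matrix may fail to be of finite type, as the entries -4 and -5 show.
  There the row of a moved index \<open>i\<close> merely ties \<open>possum x i\<close> to
  \<open>possum y i\<close>; bounds come from eliminating both numbers with the rows of a fixed
  neighbour \<open>j\<close> at the two objects. For an edge with entries \<open>- m\<close> in row
  \<open>i\<close> and \<open>- b\<close>, \<open>- c\<close> in row \<open>j\<close> at the two
  objects this gives \<open>m * b * c < 2 * (b + c)\<close>. With \<open>m = 1\<close> and
  \<open>b = 3\<close> it stops at \<open>c = 5\<close>, the origin of -4 and -5. For
  \<open>(m, b)\<close> equal to (1,1), (1,2) or (2,1) the inequality leaves \<open>c\<close>
  unbounded. The first pair contradicts (R4), the other two are settled by following one root until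
  its coefficients get opposite signs. A similar elimination along a path of three indices leaves -2
  as the only deviating entry in cases (3) and (4).\<close>

lemma finite_Iset [simp]: "finite (Iset \<theta>)"
  by (simp add: Iset_def)

lemma alpha_same [simp]: "alpha i i = 1"
  by (simp add: alpha_def)

lemma alpha_other [simp]: "k \<noteq> i \<Longrightarrow> alpha i k = 0"
  by (simp add: alpha_def)

lemma alpha_nonneg: "0 \<le> alpha i k"
  by (simp add: alpha_def)

lemma sum_alpha:
  fixes f :: "nat \<Rightarrow> int"
  assumes "finite I" "i \<in> I"
  shows "(\<Sum>j\<in>I. f j * alpha i j) = f i"
proof -
  have "(\<Sum>j\<in>I. f j * alpha i j) = (\<Sum>j\<in>I. if j = i then f i else 0)"
    by (rule sum.cong) (auto simp: alpha_def)
  then show ?thesis using assms by simp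
qed

lemma sigma_other [simp]: "k \<noteq> i \<Longrightarrow> sigma \<theta> C a i v k = v k"
  by (simp add: sigma_def)

lemma sigma_same: "sigma \<theta> C a i v i = v i - (\<Sum>j\<in>Iset \<theta>. C a i j * v j)"
  by (simp add: sigma_def)

lemma sigma_alpha:
  "i \<in> Iset \<theta> \<Longrightarrow> j \<in> Iset \<theta> \<Longrightarrow> sigma \<theta> C a i (alpha j) = (\<lambda>k. alpha j k - C a i j * alpha i k)"
  by (auto simp: sigma_def sum_alpha)

lemma sigma_uminus: "sigma \<theta> C a i (- v) = - sigma \<theta> C a i v"
  by (auto simp: sigma_def fun_eq_iff sum_negf algebra_simps)

lemma sigma_sum:
  "sigma \<theta> C a i (\<lambda>k. \<Sum>j\<in>J. c j * v j k) = (\<lambda>k. \<Sum>j\<in>J. c j * sigma \<theta> C a i (v j) k)"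
proof
  fix k
  have "(\<Sum>l\<in>Iset \<theta>. C a i l * (\<Sum>j\<in>J. c j * v j l)) = (\<Sum>j\<in>J. c j * (\<Sum>l\<in>Iset \<theta>. C a i l * v j l))"
    unfolding sum_distrib_left by (subst sum.swap) (simp add: mult_ac)
  then show "sigma \<theta> C a i (\<lambda>k. \<Sum>j\<in>J. c j * v j k) k = (\<Sum>j\<in>J. c j * sigma \<theta> C a i (v j) k)"
    by (simp add: sigma_def right_diff_distrib sum_subtractf sum_distrib_left sum_distrib_right mult_ac)
qed

lemma ZI_expand:
  assumes "v \<in> ZI \<theta>"
  shows "v = (\<lambda>k. \<Sum>j\<in>Iset \<theta>. v j * alpha j k)"
proof
  fix k
  have "(\<Sum>j\<in>Iset \<theta>. v j * alpha j k) = (\<Sum>j\<in>Iset \<theta>. if k = j then v k else 0)"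
    by (rule sum.cong) (auto simp: alpha_def)
  also have "\<dots> = v k" using assms by (simp add: ZI_def)
  finally show "v k = (\<Sum>j\<in>Iset \<theta>. v j * alpha j k)" by simp
qed

lemma fun_uminus_uminus: "- (- v) = (v :: nat \<Rightarrow> int)"
  by (simp add: fun_eq_iff)

locale roots =
  fixes \<theta> :: nat and A :: "'a set" and \<rho> :: "nat \<Rightarrow> 'a \<Rightarrow> 'a"
    and C :: "'a \<Rightarrow> nat \<Rightarrow> nat \<Rightarrow> int" and R :: "'a \<Rightarrow> (nat \<Rightarrow> int) set"
  assumes rs: "root_system \<theta> A \<rho> C R" and rank_pos: "1 \<le> \<theta>"
begin

abbreviation I where "I \<equiv> Iset \<theta>"
abbreviation s where "s \<equiv> sigma \<theta> C"

lemma Iset_ne: "1 \<in> I"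
  using rank_pos by (simp add: Iset_def)

lemma scheme: "cartan_scheme \<theta> A \<rho> C"
  using rs by (simp add: root_system_def)

lemma rho_in: "a \<in> A \<Longrightarrow> i \<in> I \<Longrightarrow> \<rho> i a \<in> A"
  and rho_rho: "a \<in> A \<Longrightarrow> i \<in> I \<Longrightarrow> \<rho> i (\<rho> i a) = a"
  and C_gcm: "a \<in> A \<Longrightarrow> gcm \<theta> (C a)"
  and C_rho: "a \<in> A \<Longrightarrow> i \<in> I \<Longrightarrow> j \<in> I \<Longrightarrow> C (\<rho> i a) i j = C a i j"
  using scheme unfolding cartan_scheme_def by (blast, blast, blast, metis)

lemma C_diag: "a \<in> A \<Longrightarrow> i \<in> I \<Longrightarrow> C a i i = 2"
  and C_nonpos: "a \<in> A \<Longrightarrow> i \<in> I \<Longrightarrow> j \<in> I \<Longrightarrow> i \<noteq> j \<Longrightarrow> C a i j \<le> 0"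
  and C_zero: "a \<in> A \<Longrightarrow> i \<in> I \<Longrightarrow> j \<in> I \<Longrightarrow> C a i j = 0 \<Longrightarrow> C a j i = 0"
  using C_gcm unfolding gcm_def by blast+

lemma C_neg:
  assumes "a \<in> A" "i \<in> I" "j \<in> I" "i \<noteq> j" "C a i j \<noteq> 0"
  shows "C a i j \<le> - 1" "C a j i \<le> - 1"
proof -
  have "C a j i \<noteq> 0" using assms C_zero[of a j i] by blast
  then show "C a i j \<le> - 1" "C a j i \<le> - 1"
    using assms C_nonpos[of a i j] C_nonpos[of a j i] by simp_all
qed

lemma R_ZI: "a \<in> A \<Longrightarrow> v \<in> R a \<Longrightarrow> v \<in> ZI \<theta>"
  using rs by (auto simp: root_system_def)

lemma R_supp: "a \<in> A \<Longrightarrow> v \<in> R a \<Longrightarrow> k \<notin> I \<Longrightarrow> v k = 0"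
  using R_ZI by (auto simp: ZI_def)

lemma R_pos: "a \<in> A \<Longrightarrow> R a = pos_part (R a) \<union> uminus ` pos_part (R a)"
  using rs by (simp add: root_system_def)

lemma R_line: "a \<in> A \<Longrightarrow> i \<in> I \<Longrightarrow> R a \<inter> range (\<lambda>n::int. (\<lambda>k. n * alpha i k)) = {alpha i, - alpha i}"
  using rs by (simp add: root_system_def)

lemma R_sigma: "a \<in> A \<Longrightarrow> i \<in> I \<Longrightarrow> s a i ` R a = R (\<rho> i a)"
  using rs by (simp add: root_system_def)

lemma R4: "a \<in> A \<Longrightarrow> i \<in> I \<Longrightarrow> j \<in> I \<Longrightarrow> i \<noteq> j \<Longrightarrow> finite (R a \<inter> rank2_pos i j) \<Longrightarrow>
    ((\<rho> i \<circ> \<rho> j) ^^ card (R a \<inter> rank2_pos i j)) a = a"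
  using rs by (simp add: root_system_def)

lemma simple_root: "a \<in> A \<Longrightarrow> i \<in> I \<Longrightarrow> alpha i \<in> R a"
  using R_line by blast

lemma R_signs: "a \<in> A \<Longrightarrow> v \<in> R a \<Longrightarrow> (\<forall>k. 0 \<le> v k) \<or> (\<forall>k. v k \<le> 0)"
  by (subst (asm) R_pos) (auto simp: pos_part_def)

lemma R_nonneg: "a \<in> A \<Longrightarrow> v \<in> R a \<Longrightarrow> 0 < v k \<Longrightarrow> 0 \<le> v l"
  using R_signs[of a v] by (auto simp: not_less[symmetric])

lemma R_uminus: "a \<in> A \<Longrightarrow> v \<in> R a \<Longrightarrow> - v \<in> R a"
proof -
  assume a: "a \<in> A" and "v \<in> R a"
  then have "v \<in> pos_part (R a) \<union> uminus ` pos_part (R a)" by (subst (asm) R_pos)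
  then have "- v \<in> pos_part (R a) \<union> uminus ` pos_part (R a)"
  proof
    assume "v \<in> uminus ` pos_part (R a)"
    then obtain u where "u \<in> pos_part (R a)" "v = - u" by blast
    then show ?thesis by (simp add: fun_uminus_uminus)
  qed simp
  then show "- v \<in> R a" by (subst R_pos[OF a])
qed

lemma R_neg_nonneg: "a \<in> A \<Longrightarrow> v \<in> R a \<Longrightarrow> \<not> (\<forall>k. 0 \<le> v k) \<Longrightarrow> - v \<in> pos_part (R a)"
  using R_signs[of a v] R_uminus[of a v] unfolding pos_part_def by fastforce

text \<open>Zero lies on the line through \<open>alpha 1\<close>, where (R2) admits only two
  vectors, both nonzero.\<close>

lemma zero_not_root: "a \<in> A \<Longrightarrow> (\<lambda>k. 0) \<notin> R a"
proof
  assume a: "a \<in> A" and "(\<lambda>k. 0) \<in> R a"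
  then have "(\<lambda>k. 0) \<in> R a \<inter> range (\<lambda>n::int. (\<lambda>k. n * alpha 1 k))"
    by (auto simp: image_iff intro!: exI[of _ 0])
  then have "(\<lambda>k. 0) \<in> {alpha 1, - alpha 1}" by (subst (asm) R_line[OF a Iset_ne])
  then show False by (auto simp: fun_eq_iff alpha_def split: if_splits)
qed

lemma sigma_root: "a \<in> A \<Longrightarrow> i \<in> I \<Longrightarrow> v \<in> R a \<Longrightarrow> s a i v \<in> R (\<rho> i a)"
  using R_sigma by blast

text \<open>By (C2) both objects have the same i-th row, and because \<open>C a i i = 2\<close> the
  reflection negates the value of that row. The second reflection therefore adds back what the first
  one removed.\<close>

lemma sigma_sigma:
  assumes "a \<in> A" "i \<in> I"
  shows "s (\<rho> i a) i (s a i v) = v"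
proof
  fix k
  have "(\<Sum>j\<in>I. C a i j * s a i v j) =
      (\<Sum>j\<in>I. C a i j * v j) - (\<Sum>j\<in>I. C a i j * v j) * (\<Sum>j\<in>I. C a i j * alpha i j)"
    by (simp add: sigma_def right_diff_distrib sum_subtractf sum_distrib_left sum_distrib_right mult_ac)
  also have "(\<Sum>j\<in>I. C a i j * alpha i j) = 2"
    using assms by (simp add: sum_alpha C_diag)
  finally have *: "(\<Sum>j\<in>I. C a i j * s a i v j) = - (\<Sum>j\<in>I. C a i j * v j)" by simp
  have "(\<Sum>j\<in>I. C (\<rho> i a) i j * s a i v j) = (\<Sum>j\<in>I. C a i j * s a i v j)"
    using assms by (intro sum.cong) (auto simp: C_rho)
  then show "s (\<rho> i a) i (s a i v) k = v k"
    using * by (cases "k = i") (auto simp: sigma_same)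
qed

lemma sigma_inj: "a \<in> A \<Longrightarrow> i \<in> I \<Longrightarrow> s a i v = s a i w \<Longrightarrow> v = w"
  using sigma_sigma[of a i v] sigma_sigma[of a i w] by metis

lemma root_multiple_simple:
  assumes "a \<in> A" "i \<in> I" "v \<in> R a" "\<And>k. k \<noteq> i \<Longrightarrow> v k = 0" "0 \<le> v i"
  shows "v = alpha i"
proof -
  have "v = (\<lambda>k. v i * alpha i k)" 
  proof
    show "v k = v i * alpha i k" for k using assms(4)[of k] by (cases "k = i") simp_all
  qed
  then have "v \<in> R a \<inter> range (\<lambda>n::int. (\<lambda>k. n * alpha i k))" using assms(3) by blast
  then have "v \<in> {alpha i, - alpha i}" using R_line[OF assms(1,2)] by simp
  then show ?thesis using assms(5) by auto
qed

text \<open>A positive root other than \<open>alpha i\<close> has a positive coordinate away from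
  \<open>i\<close>. The reflection leaves that coordinate alone, and a root with one positive
  coordinate has no negative one.\<close>

lemma sigma_pos:
  assumes "a \<in> A" "i \<in> I" "v \<in> pos_part (R a)" "v \<noteq> alpha i"
  shows "s a i v \<in> pos_part (R (\<rho> i a))" "s a i v \<noteq> alpha i"
proof -
  have v: "v \<in> R a" "\<And>k. 0 \<le> v k" using assms by (auto simp: pos_part_def)
  obtain k where k: "k \<noteq> i" "v k \<noteq> 0"
    using root_multiple_simple[OF assms(1,2) v(1)] v(2) assms(4) by blast
  then have "0 < s a i v k" using v(2)[of k] by simp
  then show "s a i v \<in> pos_part (R (\<rho> i a))"
    using R_nonneg[OF rho_in[OF assms(1,2)] sigma_root[OF assms(1,2) v(1)]] sigma_root[OF assms(1,2) v(1)]
    by (auto simp: pos_part_def)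
  show "s a i v \<noteq> alpha i"
  proof
    assume "s a i v = alpha i"
    then show False using \<open>0 < s a i v k\<close> k(1) by (simp del: sigma_other)
  qed
qed

lemma simple_pos: "a \<in> A \<Longrightarrow> i \<in> I \<Longrightarrow> alpha i \<in> pos_part (R a)"
  by (simp add: pos_part_def simple_root alpha_nonneg)

lemma sigma_pos_bij:
  assumes "a \<in> A" "i \<in> I"
  shows "bij_betw (s a i) (pos_part (R a) - {alpha i}) (pos_part (R (\<rho> i a)) - {alpha i})"
proof (rule bij_betwI[where g = "s (\<rho> i a) i"])
  show "s a i \<in> pos_part (R a) - {alpha i} \<rightarrow> pos_part (R (\<rho> i a)) - {alpha i}"
    by (rule Pi_I) (simp add: sigma_pos[OF assms])
  show "s (\<rho> i a) i \<in> pos_part (R (\<rho> i a)) - {alpha i} \<rightarrow> pos_part (R a) - {alpha i}"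
    using sigma_pos[OF rho_in[OF assms] assms(2)] by (intro Pi_I) (simp add: rho_rho[OF assms])
  show "s (\<rho> i a) i (s a i v) = v" for v by (rule sigma_sigma[OF assms])
  show "s a i (s (\<rho> i a) i v) = v" for v
    using sigma_sigma[OF rho_in[OF assms] assms(2)] by (simp add: rho_rho[OF assms])
qed

lemma finite_R_iff: "a \<in> A \<Longrightarrow> finite (R a) \<longleftrightarrow> finite (pos_part (R a))"
proof
  show "finite (R a) \<Longrightarrow> finite (pos_part (R a))"
    by (rule finite_subset[of _ "R a"]) (auto simp: pos_part_def)
  show "a \<in> A \<Longrightarrow> finite (pos_part (R a)) \<Longrightarrow> finite (R a)"
    using R_pos[of a] by (metis finite_UnI finite_imageI)
qed

lemma finite_R_rho:
  assumes "a \<in> A" "i \<in> I" "finite (R a)"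
  shows "finite (R (\<rho> i a))"
  using R_sigma[OF assms(1,2)] assms(3) by (metis finite_imageI)

section \<open>The sum of the positive roots\<close>

text \<open>The analogue of twice the Weyl vector. It is meaningful only for finite
  \<open>R a\<close>, since a sum over an infinite set is 0 by convention.\<close>

definition possum :: "'a \<Rightarrow> nat \<Rightarrow> int" where
  "possum a k = (\<Sum>v\<in>pos_part (R a). v k)"

lemma possum_pos:
  assumes "a \<in> A" "finite (R a)" "k \<in> I"
  shows "1 \<le> possum a k"
proof -
  have "alpha k k \<le> (\<Sum>v\<in>pos_part (R a). v k)"
    using assms finite_R_iff[OF assms(1)] simple_pos[OF assms(1,3)]
    by (intro member_le_sum) (auto simp: pos_part_def)
  then show ?thesis by (simp add: possum_def)
qed

text \<open>All positive roots but \<open>alpha i\<close> are permuted by the reflection, while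
  \<open>alpha i\<close> itself occurs in both sums. So the new vector is the reflected old one plus
  \<open>2 * alpha i\<close>, which is where the summand 2 comes from.\<close>

lemma possum_rho:
  assumes a: "a \<in> A" and i: "i \<in> I" and fin: "finite (R a)"
  shows "k \<noteq> i \<Longrightarrow> possum (\<rho> i a) k = possum a k"
    and "possum (\<rho> i a) i = possum a i - (\<Sum>j\<in>I. C a i j * possum a j) + 2"
proof -
  let ?P = "pos_part (R a)" and ?Q = "pos_part (R (\<rho> i a))"
  have fP: "finite ?P" using fin finite_R_iff[OF a] by simp
  have fQ: "finite ?Q" using finite_R_rho[OF a i fin] finite_R_iff[OF rho_in[OF a i]] by simp
  have P: "possum a k = alpha i k + (\<Sum>v\<in>?P - {alpha i}. v k)" for k
    using sum.remove[OF fP simple_pos[OF a i], of "\<lambda>v. v k"] by (simp add: possum_def)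
  have Q: "possum (\<rho> i a) k = alpha i k + (\<Sum>v\<in>?P - {alpha i}. s a i v k)" for k
    using sum.remove[OF fQ simple_pos[OF rho_in[OF a i] i], of "\<lambda>v. v k"]
      sum.reindex_bij_betw[OF sigma_pos_bij[OF a i], of "\<lambda>v. v k"] by (simp add: possum_def)
  show "k \<noteq> i \<Longrightarrow> possum (\<rho> i a) k = possum a k"
    by (simp add: P Q)
  have "(\<Sum>v\<in>?P - {alpha i}. s a i v i) =
      (\<Sum>v\<in>?P - {alpha i}. v i) - (\<Sum>v\<in>?P - {alpha i}. \<Sum>j\<in>I. C a i j * v j)"
    by (simp add: sigma_same sum_subtractf)
  also have "(\<Sum>v\<in>?P - {alpha i}. \<Sum>j\<in>I. C a i j * v j) =
      (\<Sum>j\<in>I. C a i j * (possum a j - alpha i j))"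
    by (subst sum.swap) (simp add: P sum_distrib_left)
  also have "\<dots> = (\<Sum>j\<in>I. C a i j * possum a j) - 2"
    using i C_diag[OF a i] by (simp add: right_diff_distrib sum_subtractf sum_alpha)
  finally show "possum (\<rho> i a) i = possum a i - (\<Sum>j\<in>I. C a i j * possum a j) + 2"
    using P[of i] Q[of i] by simp
qed

section \<open>Words of reflections\<close>

text \<open>Each reflection depends on the current object, so a word is read from a starting object,
  first letter first; \<open>obj\<close> gives the object where it ends.\<close>

fun act :: "'a \<Rightarrow> nat list \<Rightarrow> (nat \<Rightarrow> int) \<Rightarrow> nat \<Rightarrow> int" where
  "act a [] v = v"
| "act a (i # w) v = act (\<rho> i a) w (s a i v)"

fun obj :: "'a \<Rightarrow> nat list \<Rightarrow> 'a" where
  "obj a [] = a"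
| "obj a (i # w) = obj (\<rho> i a) w"

lemma act_snoc: "act a (w @ [i]) v = s (obj a w) i (act a w v)"
  by (induction w arbitrary: a v) auto

lemma obj_snoc: "obj a (w @ [i]) = \<rho> i (obj a w)"
  by (induction w arbitrary: a) auto

lemma obj_in: "a \<in> A \<Longrightarrow> set w \<subseteq> I \<Longrightarrow> obj a w \<in> A"
  by (induction w arbitrary: a) (auto simp: rho_in)

lemma act_root: "a \<in> A \<Longrightarrow> set w \<subseteq> I \<Longrightarrow> v \<in> R a \<Longrightarrow> act a w v \<in> R (obj a w)"
  by (induction w arbitrary: a v) (auto simp: rho_in sigma_root)

lemma act_surj: "a \<in> A \<Longrightarrow> set w \<subseteq> I \<Longrightarrow> u \<in> R (obj a w) \<Longrightarrow> \<exists>v\<in>R a. act a w v = u"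
proof (induction w arbitrary: a)
  case (Cons i w)
  then obtain v where v: "v \<in> R (\<rho> i a)" "act (\<rho> i a) w v = u"
    using rho_in by (metis list.set_intros(1) obj.simps(2) set_subset_Cons subset_iff)
  then obtain v' where "v' \<in> R a" "v = s a i v'"
    using R_sigma[of a i] Cons.prems by (metis imageE list.set_intros(1) subset_iff)
  then show ?case using v by auto
qed simp

lemma act_inj: "a \<in> A \<Longrightarrow> set w \<subseteq> I \<Longrightarrow> act a w v = act a w v' \<Longrightarrow> v = v'"
proof (induction w arbitrary: a v v')
  case (Cons i w)
  then have ai: "a \<in> A" "i \<in> I" and "set w \<subseteq> I" by auto
  then have "s a i v = s a i v'" using Cons.IH[OF rho_in[OF ai]] Cons.prems(3) by simp
  then show ?case by (rule sigma_inj[OF ai])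
qed simp

lemma act_uminus: "act a w (- v) = - act a w v"
  by (induction w arbitrary: a v) (auto simp: sigma_uminus)

lemma act_sum:
  "act a w (\<lambda>k. \<Sum>j\<in>J. c j * v j k) = (\<lambda>k. \<Sum>j\<in>J. c j * act a w (v j) k)"
  by (induction w arbitrary: a v) (simp_all add: sigma_sum)

text \<open>Each letter of a word makes at most one positive root negative, namely the one that is
  currently simple.\<close>

lemma finite_inversions:
  "a \<in> A \<Longrightarrow> set w \<subseteq> I \<Longrightarrow> finite {v \<in> pos_part (R a). \<not> (\<forall>k. 0 \<le> act a w v k)}"
proof (induction w arbitrary: a)
  case Nil
  have "{v \<in> pos_part (R a). \<not> (\<forall>k. 0 \<le> act a [] v k)} = {}" by (auto simp: pos_part_def)
  then show ?case by (simp only: finite.emptyI)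
next
  case (Cons i w)
  let ?N = "{v \<in> pos_part (R (\<rho> i a)). \<not> (\<forall>k. 0 \<le> act (\<rho> i a) w v k)}"
  have ai: "a \<in> A" "i \<in> I" using Cons.prems by auto
  have "finite ?N" using Cons rho_in by auto
  then have "finite (insert (alpha i) (s (\<rho> i a) i ` ?N))" by simp
  moreover have "{v \<in> pos_part (R a). \<not> (\<forall>k. 0 \<le> act a (i # w) v k)} \<subseteq> insert (alpha i) (s (\<rho> i a) i ` ?N)"
  proof
    fix v assume v: "v \<in> {v \<in> pos_part (R a). \<not> (\<forall>k. 0 \<le> act a (i # w) v k)}"
    show "v \<in> insert (alpha i) (s (\<rho> i a) i ` ?N)"
    proof (cases "v = alpha i")
      case False
      then have "s a i v \<in> ?N" using v sigma_pos[OF ai] by auto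
      then have "s (\<rho> i a) i (s a i v) \<in> s (\<rho> i a) i ` ?N" by (rule imageI)
      then show ?thesis unfolding sigma_sigma[OF ai] by (rule insertI2)
    qed simp
  qed
  ultimately show ?case by (rule finite_subset[rotated])
qed

lemma act_expand:
  assumes "a \<in> A" "v \<in> R a"
  shows "act a w v = (\<lambda>k. \<Sum>j\<in>I. v j * act a w (alpha j) k)"
  by (subst ZI_expand[OF R_ZI[OF assms]]) (rule act_sum)

text \<open>A positive root is a nonnegative combination of simple roots, so its image has no
  positive coordinate and, being nonzero, has a negative one. Hence all positive roots are
  inversions of the word, and a word has finitely many of them.\<close>

lemma finite_if_longest_word:
  assumes "a \<in> A" "set w \<subseteq> I" and neg: "\<And>i k. i \<in> I \<Longrightarrow> act a w (alpha i) k \<le> 0"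
  shows "finite (R a)"
proof -
  have "pos_part (R a) \<subseteq> {v \<in> pos_part (R a). \<not> (\<forall>k. 0 \<le> act a w v k)}"
  proof clarify
    fix v assume v: "v \<in> pos_part (R a)" "\<forall>k. 0 \<le> act a w v k"
    then have vR: "v \<in> R a" and v0: "0 \<le> v k" for k by (auto simp: pos_part_def)
    have "act a w v k \<le> 0" for k
      unfolding act_expand[OF assms(1) vR]
      by (rule sum_nonpos) (use v0 neg in \<open>auto simp: mult_nonneg_nonpos\<close>)
    then have "act a w v = (\<lambda>k. 0)" using v(2) by (intro ext) (meson antisym)
    then show False
      using act_root[OF assms(1,2) vR] zero_not_root[OF obj_in[OF assms(1,2)]] by simp
  qed
  then show ?thesis
    using finite_inversions[OF assms(1,2)] finite_R_iff[OF assms(1)] by (auto intro: finite_subset)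
qed

text \<open>Take a word that leaves as few positive roots positive as possible. If some root
  survived, a suitable further letter would turn one more root negative without turning any
  back.\<close>

lemma longest_word:
  assumes a: "a \<in> A" and fin: "finite (R a)"
  shows "\<exists>w. set w \<subseteq> I \<and> (\<forall>v\<in>pos_part (R a). \<not> (\<forall>k. 0 \<le> act a w v k))"
proof -
  define n where "n w = card {v \<in> pos_part (R a). \<forall>k. 0 \<le> act a w v k}" for w
  define w where "w = (ARG_MIN n w. set w \<subseteq> I)"
  have w: "set w \<subseteq> I" and least: "\<And>u. set u \<subseteq> I \<Longrightarrow> n w \<le> n u"
    using arg_min_nat_lemma[of "\<lambda>w. set w \<subseteq> I" "[]" n] by (auto simp: w_def)
  have "\<not> (\<forall>k. 0 \<le> act a w v k)" if v: "v \<in> pos_part (R a)" for v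
  proof
    assume pos: "\<forall>k. 0 \<le> act a w v k"
    let ?b = "obj a w"
    have b: "?b \<in> A" by (rule obj_in[OF a w])
    have vR: "v \<in> R a" using v by (simp add: pos_part_def)
    \<comment> \<open>The letter to append is a simple root at the end object whose preimage
      \<open>u\<close> is positive. If all these preimages were nonpositive, the surviving
      \<open>v\<close> would be a nonnegative combination of them and hence zero.\<close>
    have "\<exists>i\<in>I. \<exists>u\<in>pos_part (R a). act a w u = alpha i"
    proof (rule ccontr)
      assume no: "\<not> ?thesis"
      have "\<exists>u. u \<in> R a \<and> act a w u = alpha i \<and> (\<forall>k. u k \<le> 0)" if i: "i \<in> I" for i
      proof -
        obtain u where u: "u \<in> R a" "act a w u = alpha i"
          using act_surj[OF a w simple_root[OF b i]] by auto
        then show ?thesis using no i R_signs[OF a u(1)] by (auto simp: pos_part_def)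
      qed
      then obtain d where d: "\<And>i. i \<in> I \<Longrightarrow> d i \<in> R a" "\<And>i. i \<in> I \<Longrightarrow> act a w (d i) = alpha i"
        "\<And>i k. i \<in> I \<Longrightarrow> d i k \<le> 0" by metis
      let ?c = "act a w v"
      have "act a w (\<lambda>k. \<Sum>i\<in>I. ?c i * d i k) = (\<lambda>k. \<Sum>i\<in>I. ?c i * alpha i k)"
        unfolding act_sum by (simp add: d(2))
      also have "\<dots> = ?c"
        using ZI_expand[OF R_ZI[OF b act_root[OF a w vR]]] by simp
      finally have v_eq: "v = (\<lambda>k. \<Sum>i\<in>I. ?c i * d i k)"
        by (rule act_inj[OF a w, OF sym])
      have "v k \<le> 0" for k
        by (subst v_eq, rule sum_nonpos) (use pos d(3) in \<open>simp add: mult_nonneg_nonpos\<close>)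
      then have "v = (\<lambda>k. 0)" using v unfolding pos_part_def by (intro ext) (simp add: antisym)
      then show False using vR zero_not_root[OF a] by simp
    qed
    then obtain i u where i: "i \<in> I" and u: "u \<in> pos_part (R a)" "act a w u = alpha i" by auto
    \<comment> \<open>Appending \<open>i\<close> loses \<open>u\<close>, which now goes to
      \<open>- alpha i\<close>, and gains nothing.\<close>
    have "{v \<in> pos_part (R a). \<forall>k. 0 \<le> act a (w @ [i]) v k} \<subset> {v \<in> pos_part (R a). \<forall>k. 0 \<le> act a w v k}"
    proof
      show "{v \<in> pos_part (R a). \<forall>k. 0 \<le> act a (w @ [i]) v k} \<subseteq> {v \<in> pos_part (R a). \<forall>k. 0 \<le> act a w v k}"
      proof clarify
        fix v k assume v: "v \<in> pos_part (R a)" and p: "\<forall>k. 0 \<le> act a (w @ [i]) v k"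
        have vR: "v \<in> R a" using v by (simp add: pos_part_def)
        show "0 \<le> act a w v k"
        proof (rule ccontr)
          assume "\<not> 0 \<le> act a w v k"
          then have q: "- act a w v \<in> pos_part (R ?b)"
            using R_neg_nonneg[OF b act_root[OF a w vR]] by blast
          \<comment> \<open>Only \<open>- alpha i\<close> can be turned from negative to positive by
            the letter \<open>i\<close>. Its preimage is \<open>- u\<close>, which is not a positive
            root.\<close>
          have "- act a w v = alpha i"
          proof (rule ccontr)
            assume "- act a w v \<noteq> alpha i"
            then have "s ?b i (- act a w v) \<in> pos_part (R (\<rho> i ?b))"
              using sigma_pos(1)[OF b i q] by blast
            then have "0 \<le> - act a (w @ [i]) v k" for k
              by (simp add: sigma_uminus act_snoc pos_part_def)
            then have "act a (w @ [i]) v k = 0" for k using p by (simp add: antisym)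
            then have "act a (w @ [i]) v = (\<lambda>k. 0)" by (rule ext)
            then show False
              using zero_not_root[OF rho_in[OF b i]] act_root[OF a _ vR, of "w @ [i]"] w i by (simp add: obj_snoc)
          qed
          then have "act a w (- v) = act a w u" using u(2) by (simp only: act_uminus)
          then have "- v = u" by (rule act_inj[OF a w])
          then have "0 \<le> - v k" for k using u(1) by (auto simp: pos_part_def)
          moreover have "0 \<le> v k" for k using v by (simp add: pos_part_def)
          ultimately have "v k = 0" for k by (simp add: antisym)
          then have "v = (\<lambda>k. 0)" by (rule ext)
          then show False using vR zero_not_root[OF a] by simp
        qed
      qed
      have "act a (w @ [i]) u i = - 1"
        using u(2) C_diag[OF b i] i by (simp add: act_snoc sigma_alpha)
      then have "u \<notin> {v \<in> pos_part (R a). \<forall>k. 0 \<le> act a (w @ [i]) v k}" by (auto intro!: exI[of _ i])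
      moreover have "u \<in> {v \<in> pos_part (R a). \<forall>k. 0 \<le> act a w v k}" using u by (simp add: alpha_nonneg)
      ultimately show "{v \<in> pos_part (R a). \<forall>k. 0 \<le> act a (w @ [i]) v k} \<noteq> {v \<in> pos_part (R a). \<forall>k. 0 \<le> act a w v k}"
        by blast
    qed
    moreover have "finite {v \<in> pos_part (R a). \<forall>k. 0 \<le> act a w v k}" using fin finite_R_iff[OF a] by simp
    ultimately have "n (w @ [i]) < n w" unfolding n_def by (rule psubset_card_mono[rotated])
    moreover have "n w \<le> n (w @ [i])" using w i by (intro least) simp
    ultimately show False by simp
  qed
  then show ?thesis using w by blast
qed

text \<open>A root supported on neither block never becomes simple, so it stays positive along
  a longest word.\<close>

lemma decomposable_imp_reducible:
  assumes fin: "\<And>a. a \<in> A \<Longrightarrow> finite (R a)"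
    and I12: "I1 \<noteq> {}" "I2 \<noteq> {}" "I1 \<inter> I2 = {}" "I1 \<union> I2 = I"
    and C0: "\<And>a i j. a \<in> A \<Longrightarrow> i \<in> I1 \<Longrightarrow> j \<in> I2 \<Longrightarrow> C a i j = 0"
  shows "reducible_rs \<theta> A R"
proof -
  have C0': "C a j i = 0" if "a \<in> A" "i \<in> I1" "j \<in> I2" for a i j
    using C0[OF that] C_zero that I12(4) by blast
  define bad where "bad v \<longleftrightarrow> v \<notin> span_sub I1 \<and> v \<notin> span_sub I2" for v :: "nat \<Rightarrow> int"
  have not_simple: "\<not> bad (alpha i)" if "i \<in> I" for i
    using that I12 by (auto simp: bad_def span_sub_def alpha_def)
  have span_s: "s a i v \<in> span_sub J" if "a \<in> A" "i \<in> I" "v \<in> span_sub J" "J = I1 \<or> J = I2" for a i v J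
  proof (cases "i \<in> J")
    case True
    then show ?thesis using that(3) by (auto simp: span_sub_def intro: sigma_other[THEN trans])
  next
    case False
    have "C a i j * v j = 0" if "j \<in> I" for j
    proof (cases "j \<in> J")
      case True
      then have "C a i j = 0"
        using \<open>J = I1 \<or> J = I2\<close> \<open>i \<in> I\<close> False I12(4) C0[OF \<open>a \<in> A\<close>] C0'[OF \<open>a \<in> A\<close>] by blast
      then show ?thesis by simp
    next
      case False
      then show ?thesis using \<open>v \<in> span_sub J\<close> by (simp add: span_sub_def)
    qed
    then have "(\<Sum>j\<in>I. C a i j * v j) = 0" by (rule sum.neutral[rule_format])
    then have "s a i v = v" by (auto simp: sigma_def)
    then show ?thesis using that by simp
  qed
  have bad_s: "bad (s a i v)" if "a \<in> A" "i \<in> I" "bad v" for a i v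
    using that span_s[OF rho_in[OF that(1,2)] that(2), of "s a i v"] sigma_sigma[OF that(1,2), of v]
    unfolding bad_def by metis
  have stay: "a \<in> A \<Longrightarrow> set w \<subseteq> I \<Longrightarrow> v \<in> pos_part (R a) \<Longrightarrow> bad v \<Longrightarrow> act a w v \<in> pos_part (R (obj a w))" for a w v
  proof (induction w arbitrary: a v)
    case (Cons i w)
    then have "a \<in> A" "i \<in> I" by auto
    moreover have "v \<noteq> alpha i" using Cons.prems not_simple[OF \<open>i \<in> I\<close>] by blast
    ultimately show ?case using Cons sigma_pos(1)[of a i v] bad_s[of a i v] rho_in by auto
  qed simp
  have nobad: "\<not> bad v" if a: "a \<in> A" and v: "v \<in> pos_part (R a)" for a v
    using longest_word[OF a fin[OF a]] stay[OF a _ v] v by (auto simp: pos_part_def)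
  have "R a = (R a \<inter> span_sub I1) \<union> (R a \<inter> span_sub I2)" if a: "a \<in> A" for a
  proof -
    have "v \<in> span_sub I1 \<or> v \<in> span_sub I2" if v: "v \<in> R a" for v
    proof (cases "\<forall>k. 0 \<le> v k")
      case True
      then show ?thesis using nobad[OF a, of v] v by (simp add: bad_def pos_part_def)
    next
      case False
      then show ?thesis using nobad[OF a R_neg_nonneg[OF a v]] by (auto simp: bad_def span_sub_def)
    qed
    then show ?thesis by blast
  qed
  then show ?thesis unfolding reducible_rs_def using I12 by blast
qed

text \<open>The root \<open>s a i (alpha j)\<close> has j-coordinate 1 and i-coordinate
  \<open>- C a i j\<close>. A nonzero entry between the blocks would thus produce a root whose
  support meets both.\<close>

lemma reducible_imp_decomposable:
  assumes "reducible_rs \<theta> A R"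
  obtains I1 I2 where "I1 \<noteq> {}" "I2 \<noteq> {}" "I1 \<inter> I2 = {}" "I1 \<union> I2 = I"
    "\<And>a i j. a \<in> A \<Longrightarrow> i \<in> I1 \<Longrightarrow> j \<in> I2 \<Longrightarrow> C a i j = 0 \<and> C a j i = 0"
proof -
  obtain I1 I2 where I12: "I1 \<noteq> {}" "I2 \<noteq> {}" "I1 \<inter> I2 = {}" "I1 \<union> I2 = I"
    and R12: "\<forall>a\<in>A. R a = (R a \<inter> span_sub I1) \<union> (R a \<inter> span_sub I2)"
    using assms unfolding reducible_rs_def by (elim exE conjE) (rule that)
  have 0: "C a i j = 0" if a: "a \<in> A" and ij: "i \<in> I1" "j \<in> I2" for a i j
  proof (rule ccontr)
    assume nz: "C a i j \<noteq> 0"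
    have I: "i \<in> I" "j \<in> I" "i \<noteq> j" using ij I12 by auto
    have "s a i (alpha j) \<in> R (\<rho> i a)" using sigma_root[OF a I(1) simple_root[OF a I(2)]] .
    then have "s a i (alpha j) \<in> span_sub I1 \<union> span_sub I2" using bspec[OF R12 rho_in[OF a I(1)]] by blast
    moreover have "s a i (alpha j) j = 1" "s a i (alpha j) i = - C a i j"
      using I by (auto simp: sigma_alpha)
    ultimately show False using nz ij I12 unfolding span_sub_def by force
  qed
  moreover have "C a j i = 0" if "a \<in> A" "i \<in> I1" "j \<in> I2" for a i j
    using 0[OF that] C_zero[of a i j] that I12(4) by blast
  ultimately show ?thesis by (intro that[OF I12] conjI)
qed

end

section \<open>Matrices of finite type\<close>

text \<open>Permutations moving 0 contribute nothing to the bordered determinant, so it equals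
  \<open>det_I\<close>. If it vanished, there would be a kernel vector; the unit row forces its 0-th
  coordinate to be 0, and the rest is a nonzero kernel vector of \<open>M\<close>.\<close>

lemma det_I_nonzero:
  assumes ker: "\<And>v. \<forall>i\<in>Iset \<theta>. matvec \<theta> M v i = 0 \<Longrightarrow> \<forall>i\<in>Iset \<theta>. v i = 0"
  shows "det_I \<theta> M \<noteq> 0"
proof
  assume det0: "det_I \<theta> M = 0"
  \<comment> \<open>The index set starts at 1, matrices at 0: border the matrix by a unit row and column.\<close>
  define f where "f i j = (if i = 0 \<or> j = 0 then (if i = j then 1 else 0) else real_of_int (M i j))" for i j
  define N where "N = mat (Suc \<theta>) (Suc \<theta>) (\<lambda>(i, j). f i j)"
  have N: "N \<in> carrier_mat (Suc \<theta>) (Suc \<theta>)" by (simp add: N_def)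
  let ?P = "{p. p permutes {0..<Suc \<theta>}}" and ?Q = "{p. p permutes Iset \<theta>}"
  have ins: "{0..<Suc \<theta>} = insert 0 (Iset \<theta>)" by (auto simp: Iset_def)
  have QP: "?Q \<subseteq> ?P"
    unfolding ins by (auto intro: permutes_subset)
  have prod_eq: "(\<Prod>i = 0..<Suc \<theta>. N $$ (i, p i)) = f 0 (p 0) * (\<Prod>i\<in>Iset \<theta>. f i (p i))" if "p \<in> ?P" for p
  proof -
    have "(\<Prod>i = 0..<Suc \<theta>. N $$ (i, p i)) = (\<Prod>i = 0..<Suc \<theta>. f i (p i))"
    proof (rule prod.cong)
      fix i assume "i \<in> {0..<Suc \<theta>}"
      moreover from this have "p i \<in> {0..<Suc \<theta>}" using that by (simp add: permutes_in_image del: atLeastLessThan_iff)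
      ultimately show "N $$ (i, p i) = f i (p i)" by (simp add: N_def)
    qed simp
    then show ?thesis unfolding ins by (simp add: Iset_def)
  qed
  have "Determinant.det N = (\<Sum>p\<in>?P. of_int (sign p) * (f 0 (p 0) * (\<Prod>i\<in>Iset \<theta>. f i (p i))))"
    unfolding det_def'[OF N] by (intro sum.cong refl arg_cong2[where f = "(*)"] prod_eq)
  also have "\<dots> = (\<Sum>p\<in>?Q. of_int (sign p) * (f 0 (p 0) * (\<Prod>i\<in>Iset \<theta>. f i (p i))))"
  proof (rule sum.mono_neutral_right)
    show "finite ?P" by (simp add: finite_permutations)
    show "\<forall>p\<in>?P - ?Q. of_int (sign p) * (f 0 (p 0) * (\<Prod>i\<in>Iset \<theta>. f i (p i))) = (0::real)"
    proof
      fix p assume p: "p \<in> ?P - ?Q"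
      have "p 0 \<noteq> 0"
      proof
        assume "p 0 = 0"
        have "p permutes insert 0 (Iset \<theta>)" using p by (simp add: ins)
        then have "p permutes Iset \<theta>"
          by (rule permutes_superset) (use \<open>p 0 = 0\<close> in blast)
        then show False using p by simp
      qed
      then show "of_int (sign p) * (f 0 (p 0) * (\<Prod>i\<in>Iset \<theta>. f i (p i))) = (0::real)"
        by (simp add: f_def)
    qed
  qed (rule QP)
  also have "\<dots> = (\<Sum>p\<in>?Q. of_int (sign p * (\<Prod>i\<in>Iset \<theta>. M i (p i))))"
  proof (rule sum.cong)
    fix p assume p: "p \<in> ?Q"
    have "p 0 = 0" using p permutes_not_in[of p "Iset \<theta>" 0] by (simp add: Iset_def)
    moreover have "f i (p i) = of_int (M i (p i))" if "i \<in> Iset \<theta>" for i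
    proof -
      have "p i \<in> Iset \<theta>" using p that by (simp add: permutes_in_image)
      then show ?thesis using that by (auto simp: f_def Iset_def)
    qed
    ultimately show "of_int (sign p) * (f 0 (p 0) * (\<Prod>i\<in>Iset \<theta>. f i (p i))) =
        (of_int (sign p * (\<Prod>i\<in>Iset \<theta>. M i (p i))) :: real)"
      by (simp add: f_def)
  qed simp
  also have "\<dots> = of_int (det_I \<theta> M)" by (simp add: det_I_def)
  finally have "Determinant.det N = 0" using det0 by simp
  then obtain v where v: "v \<in> carrier_vec (Suc \<theta>)" "v \<noteq> 0\<^sub>v (Suc \<theta>)" "N *\<^sub>v v = 0\<^sub>v (Suc \<theta>)"
    using det_0_iff_vec_prod_zero[OF N] by blast
  have row: "(\<Sum>j = 0..<Suc \<theta>. f i j * v $ j) = 0" if i: "i < Suc \<theta>" for i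
  proof -
    have "(N *\<^sub>v v) $ i = (\<Sum>j = 0..<Suc \<theta>. N $$ (i, j) * v $ j)"
      using i v(1) by (simp add: N_def scalar_prod_def)
    also have "\<dots> = (\<Sum>j = 0..<Suc \<theta>. f i j * v $ j)"
      using i by (intro sum.cong) (auto simp: N_def)
    finally show ?thesis using v(3) i by simp
  qed
  have split: "(\<Sum>j = 0..<Suc \<theta>. f i j * v $ j) = f i 0 * v $ 0 + (\<Sum>j\<in>Iset \<theta>. f i j * v $ j)" for i
    unfolding ins by (simp add: Iset_def)
  have "v $ 0 = 0"
    using row[of 0] split[of 0] by (simp add: f_def Iset_def)
  have "matvec \<theta> M (\<lambda>j. v $ j) i = 0" if "i \<in> Iset \<theta>" for i
  proof -
    have "matvec \<theta> M (\<lambda>j. v $ j) i = (\<Sum>j\<in>Iset \<theta>. f i j * v $ j)"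
      unfolding matvec_def using that by (intro sum.cong) (auto simp: f_def Iset_def)
    then show ?thesis using row[of i] split[of i] \<open>v $ 0 = 0\<close> that by (simp add: Iset_def)
  qed
  then have "v $ i = 0" if "i \<in> Iset \<theta>" for i using ker that by blast
  then have "v $ i = 0" if "i < Suc \<theta>" for i
    using that \<open>v $ 0 = 0\<close> by (cases "i = 0") (auto simp: Iset_def)
  then have "v = 0\<^sub>v (Suc \<theta>)" using v(1) by (intro eq_vecI) auto
  then show False using v(2) by simp
qed

text \<open>Compare \<open>v\<close> with the positive vector \<open>u\<close> at an index where the ratio of their
  coordinates is minimal.\<close>

lemma matvec_nonneg_imp_nonneg:
  assumes M: "gcm \<theta> M"
    and u: "\<forall>i\<in>Iset \<theta>. 0 < u i" "\<forall>i\<in>Iset \<theta>. 0 < matvec \<theta> M u i"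
    and v: "\<forall>i\<in>Iset \<theta>. 0 \<le> matvec \<theta> M v i" and i: "i \<in> Iset \<theta>"
  shows "0 \<le> v i"
proof -
  obtain m where m: "m \<in> Iset \<theta>" "\<And>j. j \<in> Iset \<theta> \<Longrightarrow> v m / u m \<le> v j / u j"
    using ex_min_if_finite[of "(\<lambda>j. v j / u j) ` Iset \<theta>"] i by fastforce
  define t where "t = v m / u m"
  have w: "0 \<le> v j - t * u j" if "j \<in> Iset \<theta>" for j
    using m(2)[OF that] u(1) that by (simp add: t_def field_simps)
  have wm: "v m - t * u m = 0" using u(1) m(1) by (simp add: t_def less_imp_neq[symmetric])
  have "0 \<le> t"
  proof (rule ccontr)
    assume "\<not> 0 \<le> t"
    have "matvec \<theta> M v m - t * matvec \<theta> M u m = (\<Sum>j\<in>Iset \<theta>. M m j * (v j - t * u j))"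
      by (simp add: matvec_def right_diff_distrib sum_subtractf sum_distrib_left mult_ac)
    also have "\<dots> \<le> 0"
    proof (rule sum_nonpos)
      fix j assume j: "j \<in> Iset \<theta>"
      show "M m j * (v j - t * u j) \<le> 0"
      proof (cases "j = m")
        case False
        then have "M m j \<le> 0" using M m(1) j by (auto simp: gcm_def)
        then show ?thesis using w[OF j] by (simp add: mult_nonpos_nonneg)
      qed (simp add: wm)
    qed
    finally have "matvec \<theta> M v m \<le> t * matvec \<theta> M u m" by simp
    also have "\<dots> < 0" using u(2) m(1) \<open>\<not> 0 \<le> t\<close> by (simp add: mult_neg_pos)
    finally show False using v m(1) by force
  qed
  then show ?thesis using w[OF i] u(1) i by (smt (verit) mult_nonneg_nonneg)
qed

lemma indecomposableD:
  assumes "indecomposable \<theta> M" "I1 \<inter> I2 = {}" "I1 \<union> I2 = Iset \<theta>"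
    and "\<forall>i\<in>I1. \<forall>j\<in>I2. M i j = 0 \<and> M j i = 0"
  shows "I1 = {} \<or> I2 = {}"
  using assms unfolding indecomposable_def by meson

lemma finite_type_if_positive:
  assumes M: "gcm \<theta> M" and ind: "indecomposable \<theta> M"
    and u: "\<forall>i\<in>Iset \<theta>. 0 < u i" "\<forall>i\<in>Iset \<theta>. 0 < matvec \<theta> M u i"
  shows "finite_type \<theta> M"
  unfolding finite_type_def
proof (intro conjI allI impI)
  note nonneg = matvec_nonneg_imp_nonneg[OF M u]
  show "det_I \<theta> M \<noteq> 0"
  proof (rule det_I_nonzero)
    fix v assume v: "\<forall>i\<in>Iset \<theta>. matvec \<theta> M v i = 0"
    have "matvec \<theta> M (\<lambda>i. - v i) i = - matvec \<theta> M v i" for i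
      by (simp add: matvec_def sum_negf)
    then show "\<forall>i\<in>Iset \<theta>. v i = 0"
      using nonneg[of v] nonneg[of "\<lambda>i. - v i"] v by force
  qed
  show "\<exists>u. (\<forall>i\<in>Iset \<theta>. 0 < u i) \<and> (\<forall>i\<in>Iset \<theta>. 0 < matvec \<theta> M u i)" using u by blast
  fix v assume v: "\<forall>i\<in>Iset \<theta>. 0 \<le> matvec \<theta> M v i"
  \<comment> \<open>In a row belonging to a zero coordinate of \<open>v\<close> every term is
    nonpositive while the sum is nonnegative. So all terms vanish, and no entry joins
    \<open>?Z\<close> to \<open>?P\<close>.\<close>
  let ?Z = "{i \<in> Iset \<theta>. v i = 0}" and ?P = "{i \<in> Iset \<theta>. v i \<noteq> 0}"
  have "M i j = 0 \<and> M j i = 0" if i: "i \<in> ?Z" and j: "j \<in> ?P" for i j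
  proof -
    have le: "M i l * v l \<le> 0" if "l \<in> Iset \<theta>" for l
      using M i nonneg[OF v that] that by (cases "l = i") (auto simp: gcm_def mult_nonpos_nonneg)
    have "(\<Sum>l\<in>Iset \<theta>. - (M i l * v l)) = - matvec \<theta> M v i"
      by (simp add: matvec_def sum_negf)
    also have "\<dots> \<le> 0" using v i by simp
    finally have "(\<Sum>l\<in>Iset \<theta>. - (M i l * v l)) = 0"
      using sum_nonneg[of "Iset \<theta>" "\<lambda>l. - (M i l * v l)"] le by (meson antisym neg_0_le_iff_le)
    then have "M i j = 0"
      using sum_nonneg_eq_0_iff[of "Iset \<theta>" "\<lambda>l. - (M i l * v l)"] le j by auto
    then show ?thesis using M i j by (auto simp: gcm_def)
  qed
  then have zero: "\<forall>i\<in>?Z. \<forall>j\<in>?P. M i j = 0 \<and> M j i = 0" by blast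
  have "?Z = {} \<or> ?P = {}"
    by (rule indecomposableD[OF ind _ _ zero]) auto
  then show "(\<forall>i\<in>Iset \<theta>. 0 < v i) \<or> (\<forall>i\<in>Iset \<theta>. v i = 0)"
  proof
    assume "?Z = {}"
    then have "0 < v i" if "i \<in> Iset \<theta>" for i using nonneg[OF v that] that by (simp add: less_le)
    then show ?thesis by blast
  qed blast
qed

lemma two_le_add_if_one_le_mult:
  fixes x y :: real
  assumes "0 < x" "0 < y" "1 \<le> x * y"
  shows "2 \<le> x + y"
proof -
  have "2\<^sup>2 \<le> (x + y)\<^sup>2" using assms sum_squares_bound[of x y] by (simp add: power2_sum)
  then show ?thesis by (rule power2_le_imp_le) (use assms in simp)
qed

text \<open>Weighted by \<open>u\<close>, each edge contributes at least 2 to a total that is less than twice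
  the number of vertices. So the graph of the matrix is a forest and has a leaf.\<close>

lemma exists_leaf:
  fixes c :: "nat \<Rightarrow> nat \<Rightarrow> int" and u :: "nat \<Rightarrow> real"
  assumes fin: "finite J" and ne: "J \<noteq> {}"
    and diag: "\<And>i. i \<in> J \<Longrightarrow> c i i = 2"
    and off: "\<And>i j. i \<in> J \<Longrightarrow> j \<in> J \<Longrightarrow> i \<noteq> j \<Longrightarrow> c i j \<le> 0"
    and zero: "\<And>i j. i \<in> J \<Longrightarrow> j \<in> J \<Longrightarrow> c i j = 0 \<Longrightarrow> c j i = 0"
    and u: "\<And>i. i \<in> J \<Longrightarrow> 0 < u i" "\<And>i. i \<in> J \<Longrightarrow> 0 < (\<Sum>j\<in>J. c i j * u j)"
  shows "\<exists>i\<in>J. card {j \<in> J. j \<noteq> i \<and> c i j \<noteq> 0} \<le> 1"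
proof (rule ccontr)
  assume no: "\<not> ?thesis"
  \<comment> \<open>Rows divided by \<open>u i\<close>: positivity of row \<open>i\<close> says that
    the weights at \<open>i\<close> add up to less than 2, whereas the scaling cancels in
    \<open>g i j * g j i = c i j * c j i\<close>, which is at least 1 on an edge.\<close>
  define g where "g i j = (if i = j then 0 else - c i j * u j / u i)" for i j
  have row: "(\<Sum>j\<in>J. g i j) < 2" if i: "i \<in> J" for i
  proof -
    have "(\<Sum>j\<in>J. c i j * u j) = 2 * u i + (\<Sum>j\<in>J - {i}. c i j * u j)"
      using sum.remove[OF fin i, of "\<lambda>j. c i j * u j"] diag[OF i] by simp
    moreover have "(\<Sum>j\<in>J. g i j) = (\<Sum>j\<in>J - {i}. - (c i j * u j / u i))"
      using sum.remove[OF fin i, of "g i"] by (auto simp: g_def intro!: sum.cong)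
    moreover have "\<dots> = - (\<Sum>j\<in>J - {i}. c i j * u j) / u i"
      by (simp add: sum_negf sum_divide_distrib)
    ultimately have "(\<Sum>j\<in>J. g i j) = (2 * u i - (\<Sum>j\<in>J. c i j * u j)) / u i"
      by simp
    then show ?thesis using u(1,2)[OF i] by (simp add: divide_less_eq)
  qed
  have edge: "(if j \<noteq> i \<and> c i j \<noteq> 0 then 2 else 0) \<le> g i j + g j i" if ij: "i \<in> J" "j \<in> J" for i j
  proof (cases "j \<noteq> i \<and> c i j \<noteq> 0")
    case True
    then have "c i j \<noteq> 0" "c j i \<noteq> 0" using ij zero[of j i] by auto
    then have "c i j \<le> - 1" "c j i \<le> - 1" using True off[of i j] off[of j i] ij by simp_all
    then have a: "1 \<le> - real_of_int (c i j)" "1 \<le> - real_of_int (c j i)" by linarith+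
    have pos: "0 < g i j" "0 < g j i"
      using True a u(1)[OF ij(1)] u(1)[OF ij(2)] by (simp_all add: g_def divide_neg_pos mult_neg_pos)
    have "g i j * g j i = (- real_of_int (c i j)) * (- real_of_int (c j i))"
      using True u(1)[OF ij(1)] u(1)[OF ij(2)] by (simp add: g_def field_simps)
    also have "1 \<le> \<dots>" using a by (metis mult_mono' mult_1 zero_le_one)
    finally show ?thesis using two_le_add_if_one_le_mult[OF pos] True by simp
  next
    case False
    have "0 \<le> g i j" if "i \<in> J" "j \<in> J" for i j
      using off[OF that] u(1)[OF that(1)] u(1)[OF that(2)]
      by (auto simp: g_def field_simps mult_nonneg_nonpos)
    then show ?thesis using False ij by auto
  qed
  have "2 * real (card J) \<le> (\<Sum>i\<in>J. real (card {j \<in> J. j \<noteq> i \<and> c i j \<noteq> 0}))"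
  proof -
    have "(\<Sum>i\<in>J. 2) \<le> (\<Sum>i\<in>J. real (card {j \<in> J. j \<noteq> i \<and> c i j \<noteq> 0}))"
      using no by (intro sum_mono) force
    then show ?thesis by simp
  qed
  also have "2 * \<dots> = (\<Sum>i\<in>J. \<Sum>j\<in>J. if j \<noteq> i \<and> c i j \<noteq> 0 then 2 else 0)"
    using fin by (simp add: sum.If_cases Int_def sum_distrib_left mult.commute)
  also have "\<dots> \<le> (\<Sum>i\<in>J. \<Sum>j\<in>J. g i j + g j i)"
    by (intro sum_mono edge)
  also have "\<dots> = 2 * (\<Sum>i\<in>J. \<Sum>j\<in>J. g i j)"
    by (simp add: sum.distrib) (rule sum.swap)
  also have "\<dots> < 2 * (\<Sum>i\<in>J. 2)"
    using sum_strict_mono[OF fin ne, of "\<lambda>i. \<Sum>j\<in>J. g i j" "\<lambda>i. 2"] row by simp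
  finally show False by simp
qed

section \<open>Symmetrization and the invariant form\<close>

text \<open>Induction by removing a leaf. Deleting a vertex drops only nonpositive terms from the
  other rows, so \<open>u\<close> still certifies the smaller matrix; the multiplier of the leaf is
  then subject to at most one equation.\<close>

lemma symmetrizable:
  fixes c :: "nat \<Rightarrow> nat \<Rightarrow> int" and u :: "nat \<Rightarrow> real"
  assumes "finite J"
    and "\<And>i. i \<in> J \<Longrightarrow> c i i = 2"
    and "\<And>i j. i \<in> J \<Longrightarrow> j \<in> J \<Longrightarrow> i \<noteq> j \<Longrightarrow> c i j \<le> 0"
    and "\<And>i j. i \<in> J \<Longrightarrow> j \<in> J \<Longrightarrow> c i j = 0 \<Longrightarrow> c j i = 0"
    and "\<And>i. i \<in> J \<Longrightarrow> 0 < u i" "\<And>i. i \<in> J \<Longrightarrow> 0 < (\<Sum>j\<in>J. c i j * u j)"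
  shows "\<exists>d :: nat \<Rightarrow> real. (\<forall>i\<in>J. 0 < d i) \<and> (\<forall>i\<in>J. \<forall>j\<in>J. d i * c i j = d j * c j i)"
  using assms
proof (induction J rule: measure_induct_rule[where f = card])
  case (less J)
  show ?case
  proof (cases "J = {}")
    case False
    with less.prems(1) have "\<exists>i\<in>J. card {j \<in> J. j \<noteq> i \<and> c i j \<noteq> 0} \<le> 1"
      by (rule exists_leaf) (fact less.prems)+
    then obtain i where i: "i \<in> J" and leaf: "card {j \<in> J. j \<noteq> i \<and> c i j \<noteq> 0} \<le> 1"
      by blast
    let ?K = "J - {i}"
    have K: "0 < (\<Sum>j\<in>?K. c l j * u j)" if l: "l \<in> ?K" for l
    proof -
      have "c l i * u i \<le> 0" using less.prems(3)[of l i] less.prems(5)[OF i] l i by (simp add: mult_nonpos_nonneg)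
      moreover have "0 < (\<Sum>j\<in>J. c l j * u j)" using less.prems(6)[of l] l by simp
      ultimately show ?thesis using sum.remove[OF less.prems(1) i, of "\<lambda>j. c l j * u j"] by linarith
    qed
    have "\<exists>d :: nat \<Rightarrow> real. (\<forall>i\<in>?K. 0 < d i) \<and> (\<forall>i\<in>?K. \<forall>j\<in>?K. d i * c i j = d j * c j i)"
    proof (rule less.IH)
      show "card ?K < card J" using less.prems(1) i by (rule card_Diff1_less)
      show "finite ?K" using less.prems(1) by blast
      show "c i i = 2" if "i \<in> ?K" for i using that by (intro less.prems(2)) blast
      show "c i j \<le> 0" if "i \<in> ?K" "j \<in> ?K" "i \<noteq> j" for i j using that by (intro less.prems(3)) blast+
      show "c j i = 0" if "i \<in> ?K" "j \<in> ?K" "c i j = 0" for i j using that less.prems(4)[of i j] by blast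
      show "0 < u i" if "i \<in> ?K" for i using that by (intro less.prems(5)) blast
    qed (rule K)
    then obtain d :: "nat \<Rightarrow> real" where d: "\<forall>i\<in>?K. 0 < d i" "\<forall>i\<in>?K. \<forall>j\<in>?K. d i * c i j = d j * c j i"
      by blast
    show ?thesis
    proof (cases "{j \<in> J. j \<noteq> i \<and> c i j \<noteq> 0} = {}")
      case True
      then have "c i j = 0 \<and> c j i = 0" if "j \<in> ?K" for j using that less.prems(4)[of i j] i by blast
      then show ?thesis using d by (intro exI[of _ "d(i := 1)"]) auto
    next
      case False
      then have "card {j \<in> J. j \<noteq> i \<and> c i j \<noteq> 0} = 1"
        using leaf less.prems(1) by (auto simp: le_Suc_eq card_eq_0_iff)
      then obtain m where m: "{j \<in> J. j \<noteq> i \<and> c i j \<noteq> 0} = {m}" by (auto simp: card_1_singleton_iff)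
      then have mJ: "m \<in> J" "m \<noteq> i" "c i m \<noteq> 0" by auto
      have neg: "c i m < 0" "c m i < 0"
        using less.prems(3)[OF i mJ(1)] less.prems(3)[OF mJ(1) i] less.prems(4)[OF mJ(1) i] mJ(2,3) by linarith+
      have other: "c i j = 0 \<and> c j i = 0" if "j \<in> ?K" "j \<noteq> m" for j
        using that i m less.prems(4)[of i j] by blast
      \<comment> \<open>Solves \<open>?e * c i m = d m * c m i\<close> for the only neighbour
        \<open>m\<close>; both entries are negative, so \<open>?e\<close> is positive.\<close>
      let ?e = "d m * c m i / c i m"
      have "0 < ?e" using d(1) mJ neg by (simp add: divide_neg_neg mult_pos_neg)
      moreover have "?e * c i j = d j * c j i" if "j \<in> ?K" for j
        using other[OF that] neg by (cases "j = m") auto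
      ultimately show ?thesis using d by (intro exI[of _ "d(i := ?e)"]) auto
    qed
  qed simp
qed

text \<open>Completing the squares of the coordinate ratios \<open>v i / u i\<close>.\<close>

lemma symmetric_form_lower_bound:
  fixes S :: "nat \<Rightarrow> nat \<Rightarrow> real"
  assumes fin: "finite J"
    and sym: "\<And>i j. i \<in> J \<Longrightarrow> j \<in> J \<Longrightarrow> S i j = S j i"
    and off: "\<And>i j. i \<in> J \<Longrightarrow> j \<in> J \<Longrightarrow> i \<noteq> j \<Longrightarrow> S i j \<le> 0"
    and u: "\<And>i. i \<in> J \<Longrightarrow> 0 < u i"
  shows "(\<Sum>i\<in>J. (\<Sum>j\<in>J. S i j * u j) / u i * (v i)\<^sup>2) \<le> (\<Sum>i\<in>J. \<Sum>j\<in>J. S i j * v i * v j)"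
proof -
  define w where "w i = v i / u i" for i
  have v: "v i = w i * u i" if "i \<in> J" for i using u[OF that] by (simp add: w_def)
  \<comment> \<open>Doubling lets the symmetry of \<open>S\<close> distribute each weight evenly
    over \<open>(w i)\<^sup>2\<close> and \<open>(w j)\<^sup>2\<close>. The lower bound then falls
    short of the doubled form by the terms \<open>S i j * u i * u j * (w i - w j)\<^sup>2\<close>,
    none of which is positive.\<close>
  have "2 * (\<Sum>i\<in>J. (\<Sum>j\<in>J. S i j * u j) / u i * (v i)\<^sup>2) = 2 * (\<Sum>i\<in>J. \<Sum>j\<in>J. S i j * u i * u j * (w i)\<^sup>2)"
  proof (intro arg_cong[where f = "(*) 2"] sum.cong refl)
    fix i assume i: "i \<in> J"
    have scale: "x / u i * (v i)\<^sup>2 = x * (u i * (w i)\<^sup>2)" for x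
      using u[OF i] by (simp add: v[OF i] power2_eq_square)
    show "(\<Sum>j\<in>J. S i j * u j) / u i * (v i)\<^sup>2 = (\<Sum>j\<in>J. S i j * u i * u j * (w i)\<^sup>2)"
      unfolding scale sum_distrib_right by (simp add: mult_ac)
  qed
  also have "\<dots> = (\<Sum>i\<in>J. \<Sum>j\<in>J. S i j * u i * u j * (w i)\<^sup>2) + (\<Sum>i\<in>J. \<Sum>j\<in>J. S i j * u i * u j * (w j)\<^sup>2)"
  proof -
    have "(\<Sum>i\<in>J. \<Sum>j\<in>J. S i j * u i * u j * (w i)\<^sup>2) = (\<Sum>i\<in>J. \<Sum>j\<in>J. S i j * u i * u j * (w j)\<^sup>2)"
      by (subst sum.swap, intro sum.cong refl) (simp add: sym mult_ac)
    then show ?thesis by simp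
  qed
  also have "\<dots> = (\<Sum>i\<in>J. \<Sum>j\<in>J. S i j * u i * u j * ((w i)\<^sup>2 + (w j)\<^sup>2))"
    by (simp add: sum.distrib distrib_left)
  also have "\<dots> \<le> (\<Sum>i\<in>J. \<Sum>j\<in>J. 2 * (S i j * v i * v j))"
  proof (intro sum_mono)
    fix i j assume ij: "i \<in> J" "j \<in> J"
    show "S i j * u i * u j * ((w i)\<^sup>2 + (w j)\<^sup>2) \<le> 2 * (S i j * v i * v j)"
    proof (cases "i = j")
      case False
      have "S i j * u i * u j \<le> 0"
        using off[OF ij False] u ij by (simp add: mult_nonpos_nonneg less_imp_le)
      then have "S i j * u i * u j * (w i - w j)\<^sup>2 \<le> 0" by (simp add: mult_nonpos_nonneg)
      then show ?thesis using ij by (simp add: v power2_diff algebra_simps)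
    qed (use ij in \<open>simp add: v power2_eq_square algebra_simps\<close>)
  qed
  also have "\<dots> = 2 * (\<Sum>i\<in>J. \<Sum>j\<in>J. S i j * v i * v j)" by (simp add: sum_distrib_left)
  finally show ?thesis by simp
qed

context roots
begin

text \<open>With one matrix for all objects the form \<open>Q\<close> is preserved by every
  reflection, whichever object it starts from. A positive root has \<open>Q v > 0\<close>, so
  \<open>n v i > 0\<close> for some \<open>i\<close>; if the root is not simple, reflecting at
  \<open>i\<close> keeps it positive and lowers its height. The descent ends at a simple root, so
  \<open>Q\<close> is bounded on positive roots, and by the lower bound for \<open>Q\<close> so are
  their coordinates.\<close>

lemma finite_if_common_matrix:
  assumes M: "\<And>a i j. a \<in> A \<Longrightarrow> i \<in> I \<Longrightarrow> j \<in> I \<Longrightarrow> C a i j = M i j"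
    and u: "\<forall>i\<in>I. 0 < u i" "\<forall>i\<in>I. 0 < matvec \<theta> M u i"
    and a: "a \<in> A"
  shows "finite (R a)"
proof -
  have "\<exists>d :: nat \<Rightarrow> real. (\<forall>i\<in>I. 0 < d i) \<and> (\<forall>i\<in>I. \<forall>j\<in>I. d i * M i j = d j * M j i)"
  proof (rule symmetrizable[where u = u])
    show "M i i = 2" if "i \<in> I" for i using C_diag[OF a that] M[OF a that that] by simp
    show "M i j \<le> 0" if "i \<in> I" "j \<in> I" "i \<noteq> j" for i j
      using C_nonpos[OF a that] M[OF a that(1,2)] by simp
    show "M j i = 0" if "i \<in> I" "j \<in> I" "M i j = 0" for i j
      using C_zero[OF a that(1,2)] M[OF a that(1,2)] M[OF a that(2,1)] that(3) by simp
    show "0 < (\<Sum>j\<in>I. M i j * u j)" if "i \<in> I" for i using u(2) that by (simp add: matvec_def)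
  qed (use u in auto)
  then obtain d :: "nat \<Rightarrow> real" where d: "\<And>i. i \<in> I \<Longrightarrow> 0 < d i"
    "\<And>i j. i \<in> I \<Longrightarrow> j \<in> I \<Longrightarrow> d i * M i j = d j * M j i" by blast
  define S where "S i j = d i * M i j" for i j
  define Q where "Q v = (\<Sum>i\<in>I. \<Sum>j\<in>I. S i j * v i * v j)" for v :: "nat \<Rightarrow> int"
  define n where "n v i = (\<Sum>j\<in>I. M i j * v j)" for v i
  have S_sym: "S i j = S j i" if "i \<in> I" "j \<in> I" for i j using d(2)[OF that] by (simp add: S_def)
  have Sn: "(\<Sum>j\<in>I. S i j * v j) = d i * n v i" for i and v :: "nat \<Rightarrow> int"
    by (simp add: S_def n_def sum_distrib_left mult_ac)
  have s_eq: "s b i v k = v k - n v i * alpha i k" if "b \<in> A" "i \<in> I" for b i v k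
  proof -
    have "(\<Sum>j\<in>I. C b i j * v j) = n v i" unfolding n_def using M[OF that] by (intro sum.cong) auto
    then show ?thesis by (simp add: sigma_def)
  qed
  have Q_s: "Q (s b i v) = Q v" if b: "b \<in> A" and i: "i \<in> I" for b i v
  proof -
    define m where "m = real_of_int (n v i)"
    define e where "e k = real_of_int (alpha i k)" for k
    have e: "(\<Sum>k\<in>I. e k * f k) = f i" for f :: "nat \<Rightarrow> real"
    proof -
      have "(\<Sum>k\<in>I. e k * f k) = (\<Sum>k\<in>I. if k = i then f i else 0)"
        by (intro sum.cong) (auto simp: e_def alpha_def)
      then show ?thesis using i by simp
    qed
    have "Q (s b i v) = (\<Sum>k\<in>I. \<Sum>l\<in>I. S k l * v k * v l - m * (e k * (S k l * v l))
        - m * (e l * (S k l * v k)) + m * m * (e k * (e l * S k l)))"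
      unfolding Q_def by (intro sum.cong refl) (simp add: s_eq[OF b i] m_def e_def algebra_simps)
    also have "\<dots> = Q v - m * (\<Sum>k\<in>I. e k * (\<Sum>l\<in>I. S k l * v l))
        - m * (\<Sum>k\<in>I. \<Sum>l\<in>I. e l * (S k l * v k)) + m * m * (\<Sum>k\<in>I. e k * (\<Sum>l\<in>I. e l * S k l))"
      by (simp add: Q_def sum.distrib sum_subtractf sum_distrib_left)
    also have "\<dots> = Q v - m * (\<Sum>l\<in>I. S i l * v l) - m * (\<Sum>k\<in>I. S k i * v k) + m * m * S i i"
      by (simp add: e)
    also have "(\<Sum>k\<in>I. S k i * v k) = (\<Sum>l\<in>I. S i l * v l)"
      using S_sym i by (intro sum.cong) auto
    also have "S i i = 2 * d i" using C_diag[OF b i] M[OF b i i] by (simp add: S_def)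
    also have "(\<Sum>l\<in>I. S i l * v l) = d i * m" by (simp add: Sn m_def)
    finally show ?thesis by (simp add: algebra_simps)
  qed
  define E where "E i = d i * matvec \<theta> M u i / u i" for i
  have E_pos: "0 < E i" if "i \<in> I" for i using d(1)[OF that] u that by (simp add: E_def)
  have lower: "(\<Sum>i\<in>I. E i * (real_of_int (v i))\<^sup>2) \<le> Q v" for v
  proof -
    have "(\<Sum>j\<in>I. S i j * u j) = d i * matvec \<theta> M u i" for i
      by (simp add: S_def matvec_def sum_distrib_left mult_ac)
    moreover have "S i j \<le> 0" if "i \<in> I" "j \<in> I" "i \<noteq> j" for i j
      using C_nonpos[OF a that] M[OF a that(1,2)] d(1)[OF that(1)] by (simp add: S_def mult_nonneg_nonpos)
    ultimately show ?thesis
      using symmetric_form_lower_bound[of I S u "\<lambda>i. real_of_int (v i)"] S_sym u(1)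
      by (simp add: Q_def E_def)
  qed
  have lower1: "E k * (real_of_int (v k))\<^sup>2 \<le> Q v" if k: "k \<in> I" for k v
  proof -
    have "0 \<le> E i * (real_of_int (v i))\<^sup>2" if "i \<in> I" for i
      using E_pos[OF that] by simp
    then have "E k * (real_of_int (v k))\<^sup>2 \<le> (\<Sum>i\<in>I. E i * (real_of_int (v i))\<^sup>2)"
      using k by (intro member_le_sum) auto
    then show ?thesis using lower by (rule order_trans)
  qed
  \<comment> \<open>A simple root \<open>alpha i\<close> has \<open>Q\<close> value
    \<open>2 * d i\<close>; the sum bounds all of these at once.\<close>
  define D where "D = 2 * (\<Sum>i\<in>I. d i)"
  have D0: "0 \<le> D" unfolding D_def using d(1) by (simp add: sum_nonneg less_imp_le)
  have upper: "Q v \<le> D" if "b \<in> A" "v \<in> pos_part (R b)" for b v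
    using that
  proof (induction "nat (\<Sum>k\<in>I. v k)" arbitrary: b v rule: less_induct)
    case less
    have vR: "v \<in> R b" and v0: "\<And>k. 0 \<le> v k" using less.prems(2) by (auto simp: pos_part_def)
    show ?case
    proof (cases "\<exists>i\<in>I. v = alpha i")
      case True
      then obtain i where i: "i \<in> I" "v = alpha i" by blast
      have "n v i = M i i" using i by (simp add: n_def sum_alpha)
      then have ni: "n v i = 2" using M[OF a i(1) i(1)] C_diag[OF a i(1)] by simp
      have "Q v = (\<Sum>k\<in>I. v k * (\<Sum>j\<in>I. S k j * v j))"
        by (simp add: Q_def sum_distrib_left mult_ac)
      also have "\<dots> = (\<Sum>k\<in>I. v k * (d k * n v k))" by (simp add: Sn)
      also have "\<dots> = (\<Sum>k\<in>I. if k = i then 2 * d i else 0)"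
        using i(2) ni by (intro sum.cong) auto
      also have "\<dots> = 2 * d i" using i(1) by simp
      also have "d i \<le> (\<Sum>i\<in>I. d i)" using d(1) i(1) by (intro member_le_sum) (auto intro: less_imp_le)
      finally show ?thesis by (simp add: D_def)
    next
      case False
      obtain k where "v k \<noteq> 0" using zero_not_root[OF less.prems(1)] vR by (metis ext)
      then have k: "k \<in> I" "v k \<noteq> 0" using R_supp[OF less.prems(1) vR] by blast+
      have "0 < E k * (real_of_int (v k))\<^sup>2" using E_pos k by simp
      also have "\<dots> \<le> Q v" using k(1) by (rule lower1)
      finally have "0 < Q v" .
      have "\<exists>i\<in>I. 0 < n v i"
      proof (rule ccontr)
        assume "\<not> ?thesis"
        then have "v k * (d k * n v k) \<le> 0" if "k \<in> I" for k
          using d(1)[OF that] v0[of k] that by (simp add: not_less mult_nonneg_nonpos)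
        then have "(\<Sum>k\<in>I. v k * (d k * n v k)) \<le> 0" by (intro sum_nonpos)
        moreover have "Q v = (\<Sum>k\<in>I. v k * (\<Sum>j\<in>I. S k j * v j))"
          by (simp add: Q_def sum_distrib_left mult_ac)
        ultimately show False using \<open>0 < Q v\<close> by (simp add: Sn)
      qed
      then obtain i where i: "i \<in> I" "0 < n v i" by blast
      have pos: "s b i v \<in> pos_part (R (\<rho> i b))"
        using sigma_pos(1)[OF less.prems(1) i(1) less.prems(2)] False i(1) by blast
      have "(\<Sum>k\<in>I. s b i v k) = (\<Sum>k\<in>I. v k) - n v i * (\<Sum>k\<in>I. 1 * alpha i k)"
        by (simp add: s_eq[OF less.prems(1) i(1)] sum_subtractf sum_distrib_left)
      also have "(\<Sum>k\<in>I. 1 * alpha i k) = 1" using i(1) by (subst sum_alpha) auto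
      finally have "(\<Sum>k\<in>I. s b i v k) < (\<Sum>k\<in>I. v k)" using i(2) by simp
      moreover have "0 \<le> (\<Sum>k\<in>I. s b i v k)" using pos by (intro sum_nonneg) (simp add: pos_part_def)
      ultimately have "Q (s b i v) \<le> D"
        using less.hyps[OF _ rho_in[OF less.prems(1) i(1)] pos] by simp
      then show ?thesis using Q_s[OF less.prems(1) i(1)] by simp
    qed
  qed
  define K where "K = \<lceil>\<Sum>i\<in>I. D / E i\<rceil>"
  have "v k \<in> {0..K}" if v: "v \<in> pos_part (R a)" and k: "k \<in> I" for v k
  proof -
    have v0: "0 \<le> v k" using v by (simp add: pos_part_def)
    have "E k * (real_of_int (v k))\<^sup>2 \<le> D" using lower1[OF k] upper[OF a v] by (rule order_trans)
    then have "(real_of_int (v k))\<^sup>2 \<le> D / E k" using E_pos[OF k] by (simp add: field_simps)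
    also have "\<dots> \<le> (\<Sum>i\<in>I. D / E i)"
      using D0 E_pos k by (intro member_le_sum) (auto simp: less_imp_le)
    finally have "(real_of_int (v k))\<^sup>2 \<le> (\<Sum>i\<in>I. D / E i)" .
    moreover have "v k \<le> (v k)\<^sup>2"
      using v0 by (cases "v k = 0") (simp_all add: self_le_power)
    then have "real_of_int (v k) \<le> (real_of_int (v k))\<^sup>2"
      by (metis of_int_le_iff of_int_power)
    ultimately have "real_of_int (v k) \<le> (\<Sum>i\<in>I. D / E i)" by linarith
    then have "v k \<le> K" unfolding K_def by linarith
    then show ?thesis using v0 by simp
  qed
  then have "pos_part (R a) \<subseteq> {f. \<forall>x. (x \<in> I \<longrightarrow> f x \<in> {0..K}) \<and> (x \<notin> I \<longrightarrow> f x = 0)}"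
    using R_supp[OF a] by (auto simp: pos_part_def)
  then have "finite (pos_part (R a))"
    by (rule finite_subset) (rule finite_set_of_finite_funs, simp_all)
  then show ?thesis using finite_R_iff[OF a] by simp
qed

end

section \<open>Rank three vectors and Dynkin diagrams\<close>

text \<open>Also serves rank two computations, with the third index repeating the first and
  \<open>r = 0\<close>.\<close>

definition vec3 :: "nat \<Rightarrow> nat \<Rightarrow> nat \<Rightarrow> int \<Rightarrow> int \<Rightarrow> int \<Rightarrow> nat \<Rightarrow> int" where
  "vec3 i j k p q r = (\<lambda>n. p * alpha i n + q * alpha j n + r * alpha k n)"

lemma vec3_eval:
  assumes "i \<noteq> j" "i \<noteq> k" "j \<noteq> k"
  shows "vec3 i j k p q r i = p" "vec3 i j k p q r j = q" "vec3 i j k p q r k = r"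
  using assms by (simp_all add: vec3_def)

lemma alpha_vec3: "alpha i = vec3 i j k 1 0 0" "alpha j = vec3 i j k 0 1 0" "alpha k = vec3 i j k 0 0 1"
  by (simp_all add: vec3_def)

lemma sum_vec3:
  assumes "i \<in> Iset \<theta>" "j \<in> Iset \<theta>" "k \<in> Iset \<theta>"
  shows "(\<Sum>l\<in>Iset \<theta>. c l * vec3 i j k p q r l) = c i * p + c j * q + c k * r"
proof -
  have "(\<Sum>l\<in>Iset \<theta>. c l * vec3 i j k p q r l) = p * (\<Sum>l\<in>Iset \<theta>. c l * alpha i l)
      + q * (\<Sum>l\<in>Iset \<theta>. c l * alpha j l) + r * (\<Sum>l\<in>Iset \<theta>. c l * alpha k l)"
    by (simp add: vec3_def distrib_left sum.distrib sum_distrib_left mult_ac)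
  then show ?thesis using assms by (simp add: sum_alpha mult_ac)
qed

context roots
begin

lemma sigma_vec3:
  assumes "a \<in> A" "i \<in> I" "j \<in> I" "k \<in> I"
  shows "s a i (vec3 i j k p q r) = vec3 i j k (- p - C a i j * q - C a i k * r) q r"
    and "s a j (vec3 i j k p q r) = vec3 i j k p (- q - C a j i * p - C a j k * r) r"
    and "s a k (vec3 i j k p q r) = vec3 i j k p q (- r - C a k i * p - C a k j * q)"
  using assms C_diag[OF assms(1)]
  by (auto simp: sigma_def sum_vec3 fun_eq_iff) (simp_all add: vec3_def algebra_simps)

lemma vec3_nonneg:
  assumes "a \<in> A" "vec3 i j k p q r \<in> R a" "i \<noteq> j" "i \<noteq> k" "j \<noteq> k"
  shows "0 < p \<Longrightarrow> 0 \<le> q \<and> 0 \<le> r" "0 < q \<Longrightarrow> 0 \<le> p \<and> 0 \<le> r" "0 < r \<Longrightarrow> 0 \<le> p \<and> 0 \<le> q"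
  using R_nonneg[OF assms(1,2), of i j] R_nonneg[OF assms(1,2), of i k] R_nonneg[OF assms(1,2), of j i]
    R_nonneg[OF assms(1,2), of j k] R_nonneg[OF assms(1,2), of k i] R_nonneg[OF assms(1,2), of k j]
  by (simp_all add: vec3_eval[OF assms(3-5)])

section \<open>Row inequalities for small subdiagrams\<close>

abbreviation row :: "'a \<Rightarrow> nat \<Rightarrow> int" where
  "row a i \<equiv> \<Sum>k\<in>I. C a i k * possum a k"

text \<open>Off-diagonal entries are nonpositive and the coordinates of \<open>possum a\<close>
  positive, so forgetting indices can only increase a row. This allows arguing on subdiagrams of two
  to four vertices.\<close>

lemma row_le:
  assumes "a \<in> A" "finite (R a)" "J \<subseteq> I" "i \<in> J"
  shows "row a i \<le> (\<Sum>k\<in>J. C a i k * possum a k)"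
proof -
  have "C a i k * possum a k \<le> 0" if "k \<in> I - J" for k
    using C_nonpos[OF assms(1), of i k] possum_pos[OF assms(1,2), of k] that assms(3,4)
    by (intro mult_nonpos_nonneg) auto
  then have "(\<Sum>k\<in>I - J. C a i k * possum a k) \<le> 0" by (rule sum_nonpos)
  then show ?thesis using sum.subset_diff[OF assms(3), of "\<lambda>k. C a i k * possum a k"] by simp
qed

lemma row_le2:
  assumes "a \<in> A" "finite (R a)" "i \<in> I" "j \<in> I" "i \<noteq> j"
  shows "row a i \<le> 2 * possum a i + C a i j * possum a j"
  using row_le[OF assms(1,2), of "{i, j}" i] assms C_diag[OF assms(1,3)] by simp

lemma row_le3:
  assumes "a \<in> A" "finite (R a)" "i \<in> I" "j \<in> I" "k \<in> I" "distinct [i, j, k]"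
  shows "row a i \<le> 2 * possum a i + C a i j * possum a j + C a i k * possum a k"
  using row_le[OF assms(1,2), of "{i, j, k}" i] assms C_diag[OF assms(1,3)] by simp

lemma row_le4:
  assumes "a \<in> A" "finite (R a)" "i \<in> I" "j \<in> I" "k \<in> I" "l \<in> I" "distinct [i, j, k, l]"
  shows "row a i \<le> 2 * possum a i + C a i j * possum a j + C a i k * possum a k + C a i l * possum a l"
  using row_le[OF assms(1,2), of "{i, j, k, l}" i] assms C_diag[OF assms(1,3)] by simp

end

text \<open>If every row is positive, the coordinates of \<open>possum a\<close> certify that the Cartan matrix at
  \<open>a\<close> is of finite type.\<close>

locale positive_rows = roots +
  fixes a
  assumes a: "a \<in> A" and fin: "finite (R a)" and rows: "\<And>i. i \<in> I \<Longrightarrow> 0 < row a i"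
begin

abbreviation P where "P \<equiv> possum a"
abbreviation mult where "mult i j \<equiv> C a i j * C a j i"

lemma P_pos: "i \<in> I \<Longrightarrow> 1 \<le> P i"
  using possum_pos[OF a fin] .

text \<open>Row \<open>i\<close> multiplied by \<open>- C a j i\<close>. Read in row
  \<open>j\<close>: an edge of multiplicity \<open>mult i j\<close> consumes more than
  \<open>mult i j / 2\<close> times \<open>P j\<close> out of the diagonal term
  \<open>2 * P j\<close>. The multiplicities at one vertex therefore have total below 4, which is
  the principle behind most exclusions that follow.\<close>

lemma neighbour_bound:
  assumes "i \<in> I" "j \<in> I" "i \<noteq> j" "C a i j \<noteq> 0"
  shows "mult i j * P j < - 2 * C a j i * P i"
proof -
  have "0 < - C a j i" using C_neg[OF a assms] by simp
  moreover have "0 < 2 * P i + C a i j * P j"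
    using rows[OF assms(1)] row_le2[OF a fin assms(1-3)] by linarith
  ultimately have "0 < - C a j i * (2 * P i + C a i j * P j)" by (rule mult_pos_pos)
  then show ?thesis by (simp add: algebra_simps)
qed

lemma neighbour_bound_multiple:
  assumes "i \<in> I" "j \<in> I" "i \<noteq> j" "m \<le> mult i j" "1 \<le> m"
  shows "m * P j < - 2 * C a j i * P i"
proof -
  have "C a i j \<noteq> 0" using assms(4,5) by auto
  have "m * P j \<le> mult i j * P j" using assms(4) P_pos[OF assms(2)] by (intro mult_right_mono) auto
  then show ?thesis using neighbour_bound[OF assms(1-3) \<open>C a i j \<noteq> 0\<close>] by linarith
qed

lemma simple_neighbour_bound:
  assumes "i \<in> I" "j \<in> I" "i \<noteq> j" "C a i j \<noteq> 0"
  shows "P j < 2 * P i" "C a i j * P j \<le> - P j"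
proof -
  show "C a i j * P j \<le> - P j"
    using C_neg(1)[OF a assms] P_pos[OF assms(2)] mult_right_mono[of "C a i j" "- 1" "P j"] by simp
  then show "P j < 2 * P i" using rows[OF assms(1)] row_le2[OF a fin assms(1-3)] by linarith
qed

lemma mult_less_4:
  assumes "i \<in> I" "j \<in> I" "i \<noteq> j"
  shows "mult i j < 4"
proof (rule ccontr)
  assume "\<not> mult i j < 4"
  then have "4 * P j < - 2 * C a j i * P i"
    using neighbour_bound_multiple[OF assms, of 4] by simp
  moreover have "0 < 2 * P j + C a j i * P i"
    using rows[OF assms(2)] row_le2[OF a fin assms(2,1)] assms(3) by force
  ultimately show False by simp
qed

lemma no_two_multiple_edges_at_vertex:
  assumes "i \<in> I" "j \<in> I" "k \<in> I" "distinct [i, j, k]" "2 \<le> mult j i" "2 \<le> mult k i"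
  shows False
proof -
  have "2 * P i < - 2 * C a i j * P j" "2 * P i < - 2 * C a i k * P k"
    using neighbour_bound_multiple[OF assms(2,1), of 2] neighbour_bound_multiple[OF assms(3,1), of 2] assms(4-6)
    by auto
  moreover have "0 < 2 * P i + C a i j * P j + C a i k * P k"
    using rows[OF assms(1)] row_le3[OF a fin assms(1-4)] by linarith
  ultimately show False by simp
qed

text \<open>In row \<open>i\<close> the multiple edge to \<open>j\<close> uses up more than half of
  \<open>2 * P i\<close>, which leaves \<open>P k < P i\<close>; row \<open>k\<close> gives the
  reverse inequality.\<close>

lemma no_two_multiple_edges_on_path:
  assumes "j \<in> I" "i \<in> I" "k \<in> I" "l \<in> I" "distinct [j, i, k, l]"
    and "2 \<le> mult j i" "C a i k \<noteq> 0" "2 \<le> mult l k"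
  shows False
proof -
  have "C a k i \<noteq> 0" using C_zero[OF a assms(3,2)] assms(7) by blast
  have "2 * P i < - 2 * C a i j * P j" "2 * P k < - 2 * C a k l * P l"
    using neighbour_bound_multiple[OF assms(1,2), of 2] neighbour_bound_multiple[OF assms(4,3), of 2] assms(5,6,8)
    by auto
  moreover have "0 < 2 * P i + C a i j * P j + C a i k * P k"
    using rows[OF assms(2)] row_le3[OF a fin assms(2,1,3)] assms(5) by force
  moreover have "0 < 2 * P k + C a k l * P l + C a k i * P i"
    using rows[OF assms(3)] row_le3[OF a fin assms(3,4,2)] assms(5) by force
  moreover have "C a i k * P k \<le> - P k" "C a k i * P i \<le> - P i"
    using simple_neighbour_bound(2)[OF assms(2,3)] simple_neighbour_bound(2)[OF assms(3,2)]
      assms(5,7) \<open>C a k i \<noteq> 0\<close> by auto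
  ultimately show False by simp
qed

lemma triple_edge_isolated:
  assumes "i \<in> I" "j \<in> I" "k \<in> I" "distinct [i, j, k]" "3 \<le> mult i j"
  shows "C a j k = 0"
proof (rule ccontr)
  assume nz: "C a j k \<noteq> 0"
  then have "C a k j \<noteq> 0" using C_zero[OF a assms(3,2)] by blast
  have "3 * P j < - 2 * C a j i * P i"
    using neighbour_bound_multiple[OF assms(1,2), of 3] assms(4,5) by auto
  moreover have "0 < 2 * P j + C a j i * P i + C a j k * P k"
    using rows[OF assms(2)] row_le3[OF a fin assms(2,1,3)] assms(4) by force
  moreover have "C a j k * P k \<le> - P k" "P j < 2 * P k"
    using simple_neighbour_bound[OF assms(2,3)] simple_neighbour_bound[OF assms(3,2)]
      assms(4) nz \<open>C a k j \<noteq> 0\<close> by auto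
  ultimately show False by simp
qed

lemma no_multiple_edge_at_branch:
  assumes "i \<in> I" "j \<in> I" "k \<in> I" "l \<in> I" "distinct [i, j, k, l]"
    and "2 \<le> mult i j" "C a j k \<noteq> 0" "C a j l \<noteq> 0"
  shows False
proof -
  have nz: "C a k j \<noteq> 0" "C a l j \<noteq> 0"
    using C_zero[OF a assms(3,2)] C_zero[OF a assms(4,2)] assms(7,8) by blast+
  have "2 * P j < - 2 * C a j i * P i"
    using neighbour_bound_multiple[OF assms(1,2), of 2] assms(5,6) by auto
  moreover have "0 < 2 * P j + C a j i * P i + C a j k * P k + C a j l * P l"
    using rows[OF assms(2)] row_le4[OF a fin assms(2,1,3,4)] assms(5) by force
  moreover have "C a j k * P k \<le> - P k" "C a j l * P l \<le> - P l" "P j < 2 * P k" "P j < 2 * P l"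
    using simple_neighbour_bound[OF assms(2,3)] simple_neighbour_bound[OF assms(3,2)]
      simple_neighbour_bound[OF assms(2,4)] simple_neighbour_bound[OF assms(4,2)] assms(5,7,8) nz by auto
  ultimately show False by simp
qed

end

section \<open>Two objects\<close>

locale two_objects = roots \<theta> "{x, y}" \<rho> C R
  for \<theta> :: nat and x y :: 'a and \<rho> C R +
  fixes \<kappa> :: nat
  assumes xy: "x \<noteq> y" and kappa: "\<kappa> \<in> {1..\<theta>}"
    and moved: "\<forall>i\<in>{1..\<kappa>}. \<rho> i x = y \<and> \<rho> i y = x"
    and fixed: "\<forall>i\<in>{\<kappa><..\<theta>}. \<rho> i x = x \<and> \<rho> i y = y"
begin

lemma in_I: "i \<in> {1..\<kappa>} \<Longrightarrow> i \<in> I" "i \<in> {\<kappa><..\<theta>} \<Longrightarrow> i \<in> I"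
  using kappa by (auto simp: Iset_def)

lemma I_cases: "i \<in> I \<Longrightarrow> i \<in> {1..\<kappa>} \<or> i \<in> {\<kappa><..\<theta>}"
  by (auto simp: Iset_def)

lemma moved_neq_fixed: "i \<in> {1..\<kappa>} \<Longrightarrow> j \<in> {\<kappa><..\<theta>} \<Longrightarrow> i \<noteq> j"
  by auto

lemma x_in: "x \<in> {x, y}" and y_in: "y \<in> {x, y}"
  by simp_all

text \<open>The assumptions are symmetric in the two objects, so every statement is available with
  their roles exchanged.\<close>

lemma swap: "two_objects \<theta> y x \<rho> C R \<kappa>"
proof unfold_locales
  show "root_system \<theta> {y, x} \<rho> C R" using rs by (simp add: insert_commute)
qed (use rank_pos xy kappa moved fixed in auto)

lemma moved_root: "i \<in> {1..\<kappa>} \<Longrightarrow> v \<in> R x \<Longrightarrow> s x i v \<in> R y"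
  and fixed_root: "j \<in> {\<kappa><..\<theta>} \<Longrightarrow> v \<in> R x \<Longrightarrow> s x j v \<in> R x"
  using sigma_root[OF x_in] in_I moved fixed by metis+

lemma row_moved:
  assumes "i \<in> {1..\<kappa>}" "j \<in> I"
  shows "C x i j = C y i j"
  using C_rho[OF x_in in_I(1)[OF assms(1)] assms(2)] moved assms(1) by auto

lemma finite_both: "finite (R x) \<Longrightarrow> finite (R y)"
  using finite_R_rho[OF x_in Iset_ne] moved kappa by auto

lemma row_fixed:
  assumes "finite (R x)" "j \<in> {\<kappa><..\<theta>}"
  shows "row x j = 2"
  using possum_rho(2)[OF x_in in_I(2)[OF assms(2)] assms(1)] fixed assms(2) by auto

lemma possum_moved:
  assumes "finite (R x)" "i \<in> {1..\<kappa>}"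
  shows "k \<noteq> i \<Longrightarrow> possum y k = possum x k" "possum y i = possum x i - row x i + 2"
  using possum_rho[OF x_in in_I(1)[OF assms(2)] assms(1)] moved assms(2) by auto

section \<open>Edges between moved and fixed indices\<close>

text \<open>The positive roots in the plane of \<open>i\<close> and \<open>j\<close> would be the
  three of type A2, so (R4) would make the third power of \<open>\<rho> i \<circ> \<rho> j\<close>
  fix \<open>x\<close>. But this map exchanges \<open>x\<close> and \<open>y\<close>, and 3 is
  odd.\<close>

lemma no_simple_mixed_edge:
  assumes i: "i \<in> {1..\<kappa>}" and j: "j \<in> {\<kappa><..\<theta>}"
  shows "\<not> (C x i j = - 1 \<and> C x j i = - 1)"
proof
  assume C1: "C x i j = - 1 \<and> C x j i = - 1"
  have ij: "i \<noteq> j" and I: "i \<in> I" "j \<in> I" using moved_neq_fixed[OF i j] in_I i j by blast+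
  let ?v = "\<lambda>p q k. p * alpha i k + q * alpha j k"
  have ev: "?v p q i = p" "?v p q j = q" for p q using ij by auto
  have sj: "s x j (?v p q) = ?v p (p - q)" and si: "s x i (?v p q) = ?v (q - p) q" for p q
    using sigma_vec3[OF x_in I(1,2,1), of p q 0] C1 by (simp_all add: vec3_def)
  have "R x \<inter> rank2_pos i j = {alpha i, alpha j, \<lambda>k. alpha i k + alpha j k}"
  proof
    show "R x \<inter> rank2_pos i j \<subseteq> {alpha i, alpha j, \<lambda>k. alpha i k + alpha j k}"
    proof
      fix v assume "v \<in> R x \<inter> rank2_pos i j"
      then obtain p q where v: "v = ?v p q" "?v p q \<in> R x" "0 \<le> p" "0 \<le> q"
        unfolding rank2_pos_def by auto
      show "v \<in> {alpha i, alpha j, \<lambda>k. alpha i k + alpha j k}"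
      proof (cases "p = 0 \<or> q = 0")
        case True
        then have "v = alpha i \<or> v = alpha j"
        proof
          assume p: "p = 0"
          have "v = alpha j"
            by (rule root_multiple_simple[OF x_in I(2)]) (use v p in auto)
          then show ?thesis ..
        next
          assume q: "q = 0"
          have "v = alpha i"
            by (rule root_multiple_simple[OF x_in I(1)]) (use v q in auto)
          then show ?thesis ..
        qed
        then show ?thesis by blast
      next
        case False
        have r1: "?v p (p - q) \<in> R x" using fixed_root[OF j v(2)] sj by simp
        have r2: "?v (q - p) q \<in> R y" using moved_root[OF i v(2)] si by simp
        \<comment> \<open>Reflecting at \<open>j\<close> gives the coordinate \<open>p - q\<close>
          and reflecting at \<open>i\<close> gives \<open>q - p\<close>, each next to a positive
          one; so \<open>p = q\<close>, and the root reflects to a multiple of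
          \<open>alpha i\<close>.\<close>
        have "0 \<le> p - q" "0 \<le> q - p"
          using R_nonneg[OF x_in r1, of i j] R_nonneg[OF y_in r2, of j i] False v(3,4) ij by simp_all
        then have "q = p" by simp
        then have "?v p 0 = alpha i"
          by (intro root_multiple_simple[OF x_in I(1)]) (use r1 v(3) in auto)
        then have "p = 1" using ev(1)[of p 0] by (metis alpha_same)
        then show ?thesis using v(1) \<open>q = p\<close> by simp
      qed
    qed
    have "?v 1 1 \<in> R x"
      using fixed_root[OF j simple_root[OF x_in I(1)]] sj[of 1 0] by simp
    then show "{alpha i, alpha j, \<lambda>k. alpha i k + alpha j k} \<subseteq> R x \<inter> rank2_pos i j"
      using simple_root[OF x_in] I unfolding rank2_pos_def
      by (auto intro: exI[of _ 1] exI[of _ 0] simp: fun_eq_iff)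
        (rule exI[of _ 1] exI[of _ 0], simp)+
  qed
  moreover have "alpha i \<noteq> alpha j" "alpha i \<noteq> (\<lambda>k. alpha i k + alpha j k)"
    "alpha j \<noteq> (\<lambda>k. alpha i k + alpha j k)"
    using ij by (metis alpha_other alpha_same zero_neq_one, auto simp: fun_eq_iff intro: exI[of _ i] exI[of _ j])
  ultimately have card3: "card (R x \<inter> rank2_pos i j) = 3" "finite (R x \<inter> rank2_pos i j)" by simp_all
  have "((\<rho> i \<circ> \<rho> j) ^^ 3) x = x" using R4[OF x_in I ij card3(2)] card3(1) by simp
  moreover have "\<rho> i x = y" "\<rho> i y = x" "\<rho> j x = x" "\<rho> j y = y" using moved fixed i j by auto
  ultimately show False using xy by (simp add: numeral_3_eq_3)
qed

text \<open>Follow \<open>alpha i\<close> from \<open>y\<close> through the reflections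
  \<open>j\<close>, \<open>i\<close>, \<open>j\<close>, \<open>i\<close>. The two expressions are
  the coordinates of the resulting root at \<open>y\<close>, which cannot have opposite
  signs.\<close>

lemma mixed_word:
  assumes i: "i \<in> {1..\<kappa>}" and j: "j \<in> {\<kappa><..\<theta>}"
    and ab: "C x i j = - m" "C x j i = - b" "C y j i = - c"
  shows "0 < b * (m * c - 1) - c \<Longrightarrow> 0 \<le> m * (b * (m * c - 1) - c) - (m * c - 1)"
proof -
  have ij: "i \<noteq> j" and I: "i \<in> I" "j \<in> I" using moved_neq_fixed[OF i j] in_I i j by blast+
  interpret y: two_objects \<theta> y x \<rho> C R \<kappa> by (rule swap)
  have my: "C y i j = - m" using row_moved[OF i I(2)] ab(1) by simp
  let ?v = "\<lambda>p q k. p * alpha i k + q * alpha j k"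
  have sx: "s x i (?v p q) = ?v (m * q - p) q" "s x j (?v p q) = ?v p (b * p - q)" for p q
    using sigma_vec3[OF x_in I(1,2,1), of p q 0] ab by (simp_all add: vec3_def algebra_simps)
  have sy: "s y i (?v p q) = ?v (m * q - p) q" "s y j (?v p q) = ?v p (c * p - q)" for p q
    using sigma_vec3[OF y_in I(1,2,1), of p q 0] ab my by (simp_all add: vec3_def algebra_simps)
  have "?v 1 0 \<in> R y" using simple_root[OF y_in I(1)] by simp
  then have "?v 1 c \<in> R y" using y.fixed_root[OF j] sy(2)[of 1 0] by force
  then have "?v (m * c - 1) c \<in> R x" using y.moved_root[OF i] sy(1)[of 1 c] by force
  then have "?v (m * c - 1) (b * (m * c - 1) - c) \<in> R x"
    using fixed_root[OF j] sx(2)[of "m * c - 1" c] by force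
  then have r: "?v (m * (b * (m * c - 1) - c) - (m * c - 1)) (b * (m * c - 1) - c) \<in> R y"
    using moved_root[OF i] sx(1)[of "m * c - 1" "b * (m * c - 1) - c"] by force
  show "0 < b * (m * c - 1) - c \<Longrightarrow> 0 \<le> m * (b * (m * c - 1) - c) - (m * c - 1)"
    using R_nonneg[OF y_in r, of j i] ij by simp
qed

end

text \<open>Since \<open>2 * (b + c) \<le> 4 * c\<close>, the hypothesis forces
  \<open>m * b < 4\<close>, which leaves few pairs. Some of them still admit every
  \<open>c\<close>.\<close>

lemma rank_two_solutions:
  fixes m b c :: int
  assumes pos: "1 \<le> m" "1 \<le> b" "1 \<le> c" and bc: "b \<le> c"
    and less: "m * b * c < 2 * (b + c)"
  shows "m = 1 \<and> b \<le> 2 \<or> m = 1 \<and> b = 3 \<and> c \<le> 5 \<or> m = 2 \<and> b = 1 \<or> m = 3 \<and> b = 1 \<and> c = 1"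
proof -
  have "m * b < 4"
  proof (rule ccontr)
    assume "\<not> m * b < 4"
    then have "4 * c \<le> m * b * c" using pos(3) by (intro mult_right_mono) auto
    then show False using less bc by simp
  qed
  moreover have "m \<le> m * b" "b \<le> m * b" using pos by simp_all
  ultimately have "m < 4" "b < 4" by linarith+
  then have "m = 1 \<or> m = 2 \<or> m = 3" "b = 1 \<or> b = 2 \<or> b = 3" using pos by linarith+
  then show ?thesis using \<open>m * b < 4\<close> less pos bc by auto
qed

context two_objects
begin

text \<open>Row \<open>i\<close> bounds the sum \<open>possum x i + possum y i\<close> from below,
  and row \<open>j\<close> at \<open>x\<close> and at \<open>y\<close> bounds each summand from
  above, all in terms of \<open>possum x j\<close>. Eliminating gives the inequality of
  \<open>rank_two_solutions\<close>.\<close>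

lemma mixed_edge_ordered:
  assumes fin: "finite (R x)" and i: "i \<in> {1..\<kappa>}" and j: "j \<in> {\<kappa><..\<theta>}"
    and ab: "C x i j = - m" "C x j i = - b" "C y j i = - c"
    and pos: "1 \<le> m" "1 \<le> b" "1 \<le> c" and bc: "b \<le> c"
  shows "b = c \<and> (m * b = 2 \<or> m * b = 3) \<or> m = 1 \<and> b = 3 \<and> (c = 4 \<or> c = 5)"
proof -
  interpret y: two_objects \<theta> y x \<rho> C R \<kappa> by (rule swap)
  have ij: "i \<noteq> j" and I: "i \<in> I" "j \<in> I" using moved_neq_fixed[OF i j] in_I i j by blast+
  have fy: "finite (R y)" by (rule finite_both[OF fin])
  let ?p = "possum x i" and ?p' = "possum y i" and ?q = "possum x j"
  have q: "possum y j = ?q" using possum_moved(1)[OF fin i] ij by metis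
  have pq: "1 \<le> ?p" "1 \<le> ?p'" "1 \<le> ?q"
    using possum_pos[OF x_in fin] possum_pos[OF y_in fy] I by blast+
  have e1: "2 + m * ?q \<le> ?p + ?p'"
    using possum_moved(2)[OF fin i] row_le2[OF x_in fin I ij] ab by simp
  have e2: "b * ?p \<le> 2 * ?q - 2"
    using row_fixed[OF fin j] row_le2[OF x_in fin I(2,1) ij[symmetric]] ab by simp
  have e3: "c * ?p' \<le> 2 * ?q - 2"
    using y.row_fixed[OF fy j] row_le2[OF y_in fy I(2,1) ij[symmetric]] ab q by simp
  have "b * c * (2 + m * ?q) \<le> b * c * (?p + ?p')"
    using e1 pos by (intro mult_left_mono) simp_all
  also have "\<dots> = c * (b * ?p) + b * (c * ?p')" by (simp add: algebra_simps)
  also have "\<dots> \<le> c * (2 * ?q - 2) + b * (2 * ?q - 2)"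
    using e2 e3 pos by (intro add_mono mult_left_mono) simp_all
  also have "\<dots> = 2 * (b + c) * ?q - 2 * (b + c)" by (simp add: algebra_simps)
  finally have "b * c * 2 + (m * b * c) * ?q \<le> 2 * (b + c) * ?q - 2 * (b + c)"
    by (simp add: algebra_simps)
  moreover have "X < Y" if "Z * 2 + X \<le> Y - 2 * W" "0 < Z" "0 < W" for X Y Z W :: int
    using that by linarith
  moreover have "0 < b * c" "0 < b + c" using pos by simp_all
  ultimately have "(m * b * c) * ?q < 2 * (b + c) * ?q" by blast
  then have "m * b * c < 2 * (b + c)" using pq(3) by (simp add: mult_less_cancel_right)
  then have cases: "m = 1 \<and> b \<le> 2 \<or> m = 1 \<and> b = 3 \<and> c \<le> 5 \<or> m = 2 \<and> b = 1 \<or> m = 3 \<and> b = 1 \<and> c = 1"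
    by (rule rank_two_solutions[OF pos bc])
  have no1: "\<not> (m = 1 \<and> b = 1)" using no_simple_mixed_edge[OF i j] ab by simp
  \<comment> \<open>For these two pairs \<open>c\<close> is still unbounded. A larger
    \<open>c\<close> would give the root of \<open>mixed_word\<close> a positive j-coordinate and
    the i-coordinate -1.\<close>
  have "c \<le> 2" if "m = 1" "b = 2"
    using mixed_word[OF i j ab] that by (cases "c \<le> 2") simp_all
  moreover have "c \<le> 1" if "m = 2" "b = 1"
    using mixed_word[OF i j ab] that by (cases "c \<le> 1") simp_all
  ultimately show ?thesis using cases no1 pos bc by (elim disjE conjE) force+
qed

lemma mixed_edge:
  assumes fin: "finite (R x)" and i: "i \<in> {1..\<kappa>}" and j: "j \<in> {\<kappa><..\<theta>}"
  shows "C x i j = 0 \<and> C x j i = 0 \<and> C y j i = 0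
    \<or> C x j i = C y j i \<and> C x i j * C x j i \<in> {2, 3}
    \<or> C x i j = - 1 \<and> (C x j i, C y j i) \<in> {(- 3, - 4), (- 3, - 5), (- 4, - 3), (- 5, - 3)}"
proof (cases "C x i j = 0")
  case True
  then show ?thesis
    using C_zero[OF x_in, of i j] C_zero[OF y_in, of i j] row_moved[OF i, of j] in_I i j by metis
next
  case False
  interpret y: two_objects \<theta> y x \<rho> C R \<kappa> by (rule swap)
  have ij: "i \<noteq> j" and I: "i \<in> I" "j \<in> I" using moved_neq_fixed[OF i j] in_I i j by blast+
  have yx: "C y i j = C x i j" using row_moved[OF i I(2)] by simp
  define m b c where "m = - C x i j" and "b = - C x j i" and "c = - C y j i"
  have ab: "C x i j = - m" "C x j i = - b" "C y j i = - c" "C y i j = - m"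
    using yx by (simp_all add: m_def b_def c_def)
  have pos: "1 \<le> m" "1 \<le> b" "1 \<le> c"
    using C_neg[OF x_in I ij False] C_neg[OF y_in I ij] False yx by (simp_all add: m_def b_def c_def)
  have "b = c \<and> (m * b = 2 \<or> m * b = 3) \<or> m = 1 \<and> b = 3 \<and> (c = 4 \<or> c = 5) \<or> m = 1 \<and> c = 3 \<and> (b = 4 \<or> b = 5)"
  proof (cases "b \<le> c")
    case True
    show ?thesis using mixed_edge_ordered[OF fin i j ab(1-3) pos True] by blast
  next
    case False
    then have "c \<le> b" by simp
    show ?thesis
      using y.mixed_edge_ordered[OF finite_both[OF fin] i j ab(4,3,2) pos(1,3,2) \<open>c \<le> b\<close>] by blast
  qed
  then show ?thesis unfolding ab(1-3) by auto
qed

lemma mixed_edge_multiple: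
  assumes "finite (R x)" "i \<in> {1..\<kappa>}" "j \<in> {\<kappa><..\<theta>}" "C x i j \<noteq> 0"
  shows "2 \<le> C x i j * C x j i"
  using mixed_edge[OF assms(1-3)] assms(4) by auto

section \<open>Comparing the entries between fixed indices\<close>

text \<open>The root \<open>s x j (alpha k)\<close> does not involve \<open>i\<close> and is carried
  to \<open>y\<close> unchanged by the reflection at \<open>i\<close>. Reflecting it at
  \<open>j\<close> there leaves the k-coordinate 1 and the j-coordinate
  \<open>C x j k - C y j k\<close>, which must not be negative.\<close>

lemma fixed_block_mono:
  assumes i: "i \<in> {1..\<kappa>}" and jk: "j \<in> {\<kappa><..\<theta>}" "k \<in> {\<kappa><..\<theta>}" "j \<noteq> k"
    and zero: "C x i j = 0" "C x i k = 0"
  shows "C y j k \<le> C x j k"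
proof -
  interpret y: two_objects \<theta> y x \<rho> C R \<kappa> by (rule swap)
  have I: "i \<in> I" "j \<in> I" "k \<in> I" and d: "i \<noteq> j" "i \<noteq> k"
    using moved_neq_fixed[OF i] in_I i jk by blast+
  have z': "C y j i = 0" using C_zero[OF y_in I(1,2)] row_moved[OF i I(2)] zero by simp
  have "vec3 i j k 0 (- C x j k) 1 \<in> R x"
    using fixed_root[OF jk(1) simple_root[OF x_in I(3)]] sigma_vec3(2)[OF x_in I, of 0 0 1]
    by (simp add: alpha_vec3(3)[of k i j])
  then have "vec3 i j k 0 (- C x j k) 1 \<in> R y"
    using moved_root[OF i] sigma_vec3(1)[OF x_in I, of 0 "- C x j k" 1] zero by force
  then have "s y j (vec3 i j k 0 (- C x j k) 1) \<in> R y" by (rule y.fixed_root[OF jk(1)])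
  then have "vec3 i j k 0 (C x j k - C y j k) 1 \<in> R y"
    using sigma_vec3(2)[OF y_in I, of 0 "- C x j k" 1] by simp
  then show ?thesis using vec3_nonneg(3)[OF y_in _ d jk(3)] by force
qed

lemma fixed_block_eq:
  assumes i: "i \<in> {1..\<kappa>}" and jk: "j \<in> {\<kappa><..\<theta>}" "k \<in> {\<kappa><..\<theta>}" "j \<noteq> k"
    and zero: "C x i j = 0" "C x i k = 0"
  shows "C x j k = C y j k"
proof -
  interpret y: two_objects \<theta> y x \<rho> C R \<kappa> by (rule swap)
  have "C y i j = 0" "C y i k = 0" using row_moved[OF i] in_I jk zero by metis+
  then show ?thesis
    using fixed_block_mono[OF assms] y.fixed_block_mono[OF i jk] by simp
qed

text \<open>If \<open>C x j k\<close> were nonzero, \<open>s x j (alpha k)\<close> would acquire a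
  positive i-coordinate on its way to \<open>y\<close>. At \<open>y\<close> the index
  \<open>k\<close> is joined to neither \<open>i\<close> nor \<open>j\<close>, so the reflection at
  \<open>k\<close> only changes the k-coordinate 1 to -1, giving mixed signs.\<close>

lemma fixed_block_zero:
  assumes i: "i \<in> {1..\<kappa>}" and jk: "j \<in> {\<kappa><..\<theta>}" "k \<in> {\<kappa><..\<theta>}" "j \<noteq> k"
    and adj: "C x i j \<noteq> 0" "C x i k = 0" and zero: "C y j k = 0"
  shows "C x j k = 0"
proof (rule ccontr)
  assume nz: "C x j k \<noteq> 0"
  interpret y: two_objects \<theta> y x \<rho> C R \<kappa> by (rule swap)
  have I: "i \<in> I" "j \<in> I" "k \<in> I" and d: "i \<noteq> j" "i \<noteq> k"
    using moved_neq_fixed[OF i] in_I i jk by blast+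
  have z: "C y k j = 0" "C y k i = 0"
    using C_zero[OF y_in I(2,3) zero] C_zero[OF y_in I(1,3)] row_moved[OF i I(3)] adj by simp_all
  have neg: "C x j k \<le> - 1" "C x i j \<le> - 1"
    using C_neg(1)[OF x_in I(2,3) jk(3) nz] C_neg(1)[OF x_in I(1,2) d(1) adj(1)] by auto
  have "vec3 i j k 0 (- C x j k) 1 \<in> R x"
    using fixed_root[OF jk(1) simple_root[OF x_in I(3)]] sigma_vec3(2)[OF x_in I, of 0 0 1]
    by (simp add: alpha_vec3(3)[of k i j])
  then have "vec3 i j k (C x i j * C x j k) (- C x j k) 1 \<in> R y"
    using moved_root[OF i] sigma_vec3(1)[OF x_in I, of 0 "- C x j k" 1] adj by force
  then have "vec3 i j k (C x i j * C x j k) (- C x j k) (- 1) \<in> R y"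
    using y.fixed_root[OF jk(2)] sigma_vec3(3)[OF y_in I, of "C x i j * C x j k" "- C x j k" 1] z by force
  moreover have "0 < C x i j * C x j k" using neg by (simp add: mult_neg_neg)
  ultimately show False using vec3_nonneg(1)[OF y_in _ d jk(3)] by force
qed

text \<open>A single object need not have positive rows. For equal matrices the vector
  \<open>possum x + possum y\<close> works: at a moved index the differences of the two coordinates
  cancel, so all its rows equal 4.\<close>

lemma case1_if_equal:
  assumes fin: "finite (R x)" and irr: "irreducible_rs \<theta> {x, y} R"
    and eq: "\<And>i j. i \<in> I \<Longrightarrow> j \<in> I \<Longrightarrow> C x i j = C y i j"
  shows "case1 \<theta> \<kappa> (C x) (C y)"
proof -
  interpret y: two_objects \<theta> y x \<rho> C R \<kappa> by (rule swap)
  have fy: "finite (R y)" by (rule finite_both[OF fin])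
  have ind: "indecomposable \<theta> (C x)"
  proof (rule ccontr)
    assume "\<not> ?thesis"
    then obtain I1 I2 where I12: "I1 \<noteq> {}" "I2 \<noteq> {}" "I1 \<inter> I2 = {}" "I1 \<union> I2 = I"
      and z: "\<forall>i\<in>I1. \<forall>j\<in>I2. C x i j = 0 \<and> C x j i = 0"
      unfolding indecomposable_def by blast
    have "reducible_rs \<theta> {x, y} R"
    proof (rule decomposable_imp_reducible[OF _ I12])
      show "finite (R a)" if "a \<in> {x, y}" for a using that fin fy by blast
      show "C a i j = 0" if a: "a \<in> {x, y}" "i \<in> I1" "j \<in> I2" for a i j
        using a z eq[of i j] I12(4) by auto
    qed
    then show False using irr by (simp add: irreducible_rs_def)
  qed
  define u where "u k = real_of_int (possum x k + possum y k)" for k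
  have "finite_type \<theta> (C x)"
  proof (rule finite_type_if_positive[OF C_gcm[OF x_in] ind])
    show "\<forall>i\<in>I. 0 < u i"
      using possum_pos[OF x_in fin] possum_pos[OF y_in fy] by (force simp: u_def)
    show "\<forall>i\<in>I. 0 < matvec \<theta> (C x) u i"
    proof
      fix i assume i: "i \<in> I"
      have yrow: "(\<Sum>k\<in>I. C x i k * possum y k) = row y i"
        using eq[OF i] by (intro sum.cong) auto
      have "matvec \<theta> (C x) u i = real_of_int (row x i + row y i)"
        by (simp add: matvec_def u_def yrow[symmetric] sum.distrib distrib_left)
      moreover have "row x i + row y i = 4"
        using I_cases[OF i]
      proof
        assume "i \<in> {1..\<kappa>}"
        then show ?thesis using possum_moved(2)[OF fin] y.possum_moved(2)[OF fy] by force
      next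
        assume "i \<in> {\<kappa><..\<theta>}"
        then show ?thesis using row_fixed[OF fin] y.row_fixed[OF fy] by simp
      qed
      ultimately show "0 < matvec \<theta> (C x) u i" by simp
    qed
  qed
  moreover have "C x i j * C x j i \<noteq> 1" if "i \<in> I" "j \<in> I" "i \<le> \<kappa> \<and> \<kappa> < j" for i j
  proof -
    have "i \<in> {1..\<kappa>}" "j \<in> {\<kappa><..\<theta>}" using that by (auto simp: Iset_def)
    then show ?thesis using mixed_edge[OF fin, of i j] by auto
  qed
  ultimately show ?thesis
    using kappa eq ind C_gcm[OF x_in] by (auto simp: case1_def cartan_finite_type_def Iset_def)
qed

lemma classified_id:
  assumes "case1 \<theta> \<kappa> (C x) (C y) \<or> case2 \<theta> \<kappa> (C y) (C x)"
  shows "classified \<theta> \<kappa> x y C"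
proof -
  have "(id :: nat \<Rightarrow> nat) permutes Iset \<theta>" by (rule permutes_id)
  then show ?thesis
    using assms unfolding classified_def Let_def
    by (elim disjE) (rule exI[of _ id], force)+
qed

text \<open>Edges from moved to fixed indices are multiple. Two of them ending on the edge
  \<open>j\<close>, \<open>k\<close> either meet at a vertex or sit at the two ends of a path, and
  both configurations are excluded.\<close>

lemma no_two_moved_neighbours:
  assumes fin: "finite (R x)" and rows: "\<And>i. i \<in> I \<Longrightarrow> 0 < row x i"
    and ii: "i \<in> {1..\<kappa>}" "i' \<in> {1..\<kappa>}" "i \<noteq> i'"
    and jk: "j \<in> {\<kappa><..\<theta>}" "k \<in> {\<kappa><..\<theta>}" "j \<noteq> k" "C x j k \<noteq> 0"
    and adj: "C x i j \<noteq> 0 \<or> C x i k \<noteq> 0" "C x i' j \<noteq> 0 \<or> C x i' k \<noteq> 0"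
  shows False
proof -
  interpret pr: positive_rows \<theta> "{x, y}" \<rho> C R x
    by unfold_locales (use fin rows in auto)
  have I: "i \<in> I" "i' \<in> I" "j \<in> I" "k \<in> I" using ii jk in_I by blast+
  have d: "i \<noteq> j" "i \<noteq> k" "i' \<noteq> j" "i' \<noteq> k" using ii jk by auto
  have kj: "C x k j \<noteq> 0" using jk(4) C_zero[OF x_in I(4,3)] by blast
  note multiple = mixed_edge_multiple[OF fin]
  have no: "C x i m = 0 \<or> C x i' m = 0" if m: "m \<in> {\<kappa><..\<theta>}" for m
  proof (rule ccontr)
    assume "\<not> ?thesis"
    then have "2 \<le> pr.mult i m" "2 \<le> pr.mult i' m" using multiple ii(1,2) m by blast+
    moreover have "distinct [m, i, i']" using ii m by auto
    ultimately show False using pr.no_two_multiple_edges_at_vertex in_I(2)[OF m] I(1,2) by blast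
  qed
  have no': "C x l j = 0 \<or> C x l' k = 0" if l: "l \<in> {1..\<kappa>}" "l' \<in> {1..\<kappa>}" "l \<noteq> l'" for l l'
  proof (rule ccontr)
    assume "\<not> ?thesis"
    then have "2 \<le> pr.mult l j" "2 \<le> pr.mult l' k" using multiple l(1,2) jk(1,2) by blast+
    moreover have "distinct [l, j, k, l']" using l jk by auto
    ultimately show False
      using pr.no_two_multiple_edges_on_path[OF in_I(1)[OF l(1)] I(3,4) in_I(1)[OF l(2)]] jk(4) by blast
  qed
  show False
    using adj no[OF jk(1)] no[OF jk(2)] no'[OF ii] no'[OF ii(2,1) ii(3)[symmetric]] by blast
qed

lemma equal_if_two_moved:
  assumes fin: "finite (R x)" and two: "2 \<le> \<kappa>" and ij: "i \<in> I" "j \<in> I"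
  shows "C x i j = C y i j"
proof -
  interpret y: two_objects \<theta> y x \<rho> C R \<kappa> by (rule swap)
  have fy: "finite (R y)" by (rule finite_both[OF fin])
  have m: "1 \<in> {1..\<kappa>}" "2 \<in> {1..\<kappa>}" using two by auto
  \<comment> \<open>Moving along 1 allows a difference at coordinate 1 only, moving along 2 at
    coordinate 2 only; hence there is none.\<close>
  have same: "possum x k = possum y k" for k
    using possum_moved(1)[OF fin m(1), of k] possum_moved(1)[OF fin m(2), of k] by (cases "k = 1") auto
  have rows: "0 < row x i" if "i \<in> I" for i
    using I_cases[OF that] possum_moved(2)[OF fin, of i] row_fixed[OF fin, of i] same[of i] by fastforce
  have rowsy: "0 < row y i" if "i \<in> I" for i
    using I_cases[OF that] y.possum_moved(2)[OF fy, of i] y.row_fixed[OF fy, of i] same[of i] by fastforce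
  interpret px: positive_rows \<theta> "{x, y}" \<rho> C R x
    by unfold_locales (use fin rows in auto)
  interpret py: positive_rows \<theta> "{x, y}" \<rho> C R y
    by unfold_locales (use fy rowsy in auto)
  show ?thesis
  proof (cases "i \<in> {1..\<kappa>} \<or> i = j")
    case True
    then show ?thesis using row_moved[of i j] ij C_diag[OF x_in ij(1)] C_diag[OF y_in ij(1)] by auto
  next
    case False
    then have i: "i \<in> {\<kappa><..\<theta>}" and d: "i \<noteq> j" using I_cases[OF ij(1)] by auto
    show ?thesis
      using I_cases[OF ij(2)]
    proof
      assume j: "j \<in> {1..\<kappa>}"
      \<comment> \<open>Among the possibilities for a mixed edge, the unequal ones have product 4 or
        5 at one object, which positive rows forbid.\<close>
      show ?thesis
        using mixed_edge[OF fin j i] px.mult_less_4[OF ij(2,1) d[symmetric]]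
          py.mult_less_4[OF ij(2,1) d[symmetric]] row_moved[OF j ij(1)] by auto
    next
      assume j: "j \<in> {\<kappa><..\<theta>}"
      show ?thesis
      proof (rule ccontr)
        assume ne: "C x i j \<noteq> C y i j"
        \<comment> \<open>A moved index joined to neither \<open>i\<close> nor \<open>j\<close>
          would force the entries to agree.\<close>
        have adj: "C x l i \<noteq> 0 \<or> C x l j \<noteq> 0" if "l \<in> {1..\<kappa>}" for l
          using fixed_block_eq[OF that i j d] ne by blast
        have adjy: "C y l i \<noteq> 0 \<or> C y l j \<noteq> 0" if "l \<in> {1..\<kappa>}" for l
          using adj[OF that] row_moved[OF that] ij by metis
        have "C x i j \<noteq> 0 \<or> C y i j \<noteq> 0" using ne by auto
        then show False
          using no_two_moved_neighbours[OF fin rows m _ i j d _ adj[OF m(1)] adj[OF m(2)]]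
            y.no_two_moved_neighbours[OF fy _ m _ i j d _ adjy[OF m(1)] adjy[OF m(2)]] rowsy
          by fastforce
      qed
    qed
  qed
qed

text \<open>Serves to pin down the rank once a few indices are known to have no further neighbours
  at either object.\<close>

lemma isolated_block_total:
  assumes fin: "finite (R x)" and irr: "irreducible_rs \<theta> {x, y} R"
    and J: "J \<subseteq> I" "J \<noteq> {}"
    and zero: "\<And>i j. i \<in> J \<Longrightarrow> j \<in> I - J \<Longrightarrow> C x i j = 0 \<and> C y i j = 0"
  shows "J = I"
proof (rule ccontr)
  assume "J \<noteq> I"
  then have J2: "I - J \<noteq> {}" "J \<inter> (I - J) = {}" "J \<union> (I - J) = I" using J(1) by auto
  have "reducible_rs \<theta> {x, y} R"
  proof (rule decomposable_imp_reducible[OF _ J(2) J2])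
    show "finite (R a)" if "a \<in> {x, y}" for a using that fin finite_both by blast
    show "C a i j = 0" if "a \<in> {x, y}" "i \<in> J" "j \<in> I - J" for a i j
      using zero[OF that(2,3)] that(1) by auto
  qed
  then show False using irr by (simp add: irreducible_rs_def)
qed

text \<open>Positive rows at \<open>y\<close> select -3 there, so -4 or -5 belongs to
  \<open>x\<close>. A triple edge has no further neighbours at \<open>y\<close>; this carries over
  to \<open>x\<close>, and only two indices remain.\<close>

lemma case2_if_mixed_differs:
  assumes fin: "finite (R x)" and irr: "irreducible_rs \<theta> {x, y} R" and one: "\<kappa> = 1"
    and rows: "\<And>i. i \<in> I \<Longrightarrow> 0 < row y i"
    and j: "j \<in> {\<kappa><..\<theta>}" and ne: "C x j 1 \<noteq> C y j 1"
  shows "case2 \<theta> \<kappa> (C y) (C x)"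
proof -
  interpret py: positive_rows \<theta> "{x, y}" \<rho> C R y
    by unfold_locales (use finite_both[OF fin] rows in auto)
  have m1: "1 \<in> {1..\<kappa>}" using one by simp
  have I: "1 \<in> I" "j \<in> I" and d: "1 \<noteq> j" using in_I(1)[OF m1] in_I(2)[OF j] j one by auto
  have y1j: "C y 1 j = C x 1 j" using row_moved[OF m1 I(2)] by simp
  have C1: "C x 1 j = - 1" "C y 1 j = - 1" "C y j 1 = - 3" "C x j 1 \<in> {- 4, - 5}"
    using mixed_edge[OF fin m1 j] ne py.mult_less_4[OF I d] y1j by auto
  have I_eq: "{1, j} = I"
  proof (rule isolated_block_total[OF fin irr])
    fix i k assume i: "i \<in> {1, j}" and "k \<in> I - {1, j}"
    then have k: "k \<in> I" "distinct [1, j, k]" "k \<in> {\<kappa><..\<theta>}" using one d by (auto simp: Iset_def)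
    have yjk: "C y j k = 0"
      using py.triple_edge_isolated[OF I k(1,2)] C1 by simp
    have y1k: "C y 1 k = 0"
      using py.triple_edge_isolated[OF I(2,1) k(1)] k(2) C1 by simp
    have x1k: "C x 1 k = 0" using y1k row_moved[OF m1 k(1)] by simp
    have "C x j k = 0"
      by (rule fixed_block_zero[OF m1 j k(3) _ _ x1k yjk]) (use k(2) C1 in auto)
    then show "C x i k = 0 \<and> C y i k = 0" using i yjk y1k x1k by auto
  qed (use I in auto)
  have "card I = 2" unfolding I_eq[symmetric] using d by simp
  then have "\<theta> = 2" by (simp add: Iset_def)
  then have "j = 2" using j one by auto
  then show ?thesis using C1 one \<open>\<theta> = 2\<close> by (auto simp: case2_def)
qed

text \<open>At \<open>y\<close> the diagram rules apply: the edge from 1 to \<open>j\<close> must be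
  double, as a triple one would isolate \<open>j\<close> from \<open>k\<close>, and the edge from
  \<open>j\<close> to \<open>k\<close> must then be simple. At \<open>x\<close> the entries are
  found from mixed signs and from row inequalities.\<close>

lemma classified_if_fixed_block_differs:
  assumes fin: "finite (R x)" and irr: "irreducible_rs \<theta> {x, y} R" and one: "\<kappa> = 1"
    and rows: "\<And>i. i \<in> I \<Longrightarrow> 0 < row y i"
    and same: "\<And>j. j \<in> {\<kappa><..\<theta>} \<Longrightarrow> C x j 1 = C y j 1"
    and jk: "j \<in> {\<kappa><..\<theta>}" "k \<in> {\<kappa><..\<theta>}" "j \<noteq> k"
    and ne: "C x j k \<noteq> C y j k \<or> C x k j \<noteq> C y k j"
    and adj: "C x 1 j \<noteq> 0"
  shows "classified \<theta> \<kappa> x y C"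
proof -
  interpret y: two_objects \<theta> y x \<rho> C R \<kappa> by (rule swap)
  have fy: "finite (R y)" by (rule finite_both[OF fin])
  interpret py: positive_rows \<theta> "{x, y}" \<rho> C R y
    by unfold_locales (use fy rows in auto)
  have m1: "1 \<in> {1..\<kappa>}" using one by simp
  have I: "1 \<in> I" "j \<in> I" "k \<in> I" and d: "1 \<noteq> j" "1 \<noteq> k" using in_I(1)[OF m1] in_I(2) jk one by auto
  have d3: "distinct [1, j, k]" using d jk(3) by simp
  have y1: "C y 1 l = C x 1 l" if "l \<in> I" for l using row_moved[OF m1 that] by simp
  have y1j: "C y 1 j = C x 1 j" using y1[OF I(2)] .
  have mult1: "2 \<le> C y 1 l * C y l 1" if "l \<in> {\<kappa><..\<theta>}" "C x 1 l \<noteq> 0" for l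
    using mixed_edge_multiple[OF fin m1 that] same[OF that(1)] y1[OF in_I(2)[OF that(1)]] by simp
  have unique: "C x 1 l = 0" if "l \<in> {\<kappa><..\<theta>}" "l \<noteq> j" for l
  proof (rule ccontr)
    assume l: "C x 1 l \<noteq> 0"
    have "distinct [1, j, l]" using d that one by auto
    then show False
      using py.no_two_multiple_edges_at_vertex[OF I(1,2) in_I(2)[OF that(1)]]
        mult1[OF jk(1) adj] mult1[OF that(1) l] by (simp add: mult.commute)
  qed
  have x1k: "C x 1 k = 0" using unique jk(2,3) by blast
  then have y1k: "C y 1 k = 0" using y1[OF I(3)] by simp
  have yjk0: "C y j k \<noteq> 0"
  proof
    assume z: "C y j k = 0"
    then have "C x j k = 0" by (rule fixed_block_zero[OF m1 jk adj x1k])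
    then show False using z ne C_zero[OF x_in I(2,3)] C_zero[OF y_in I(2,3)] by simp
  qed
  have xjk0: "C x j k \<noteq> 0"
  proof
    assume "C x j k = 0"
    then have "C y j k = 0"
      using y.fixed_block_zero[OF m1 jk _ y1k] adj y1j by simp
    then show False using yjk0 by simp
  qed
  have product: "C x 1 j * C x j 1 = 2"
  proof -
    have "\<not> 3 \<le> py.mult 1 j" using py.triple_edge_isolated[OF I d3] yjk0 by blast
    then show ?thesis
      using mixed_edge[OF fin m1 jk(1)] adj same[OF jk(1)] y1j by auto
  qed
  have yjk: "C y j k = - 1" "C y k j = - 1"
  proof -
    have neg: "C y j k \<le> - 1" "C y k j \<le> - 1" using C_neg[OF y_in I(2,3) jk(3) yjk0] .
    have "\<not> 2 \<le> C y k j * C y j k"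
      using py.no_two_multiple_edges_at_vertex[OF I(2,1,3)] d3 mult1[OF jk(1) adj] by auto
    moreover have "- C y k j * 1 \<le> - C y k j * - C y j k" "1 * - C y j k \<le> - C y k j * - C y j k"
      using neg by (intro mult_mono; simp)+
    ultimately show "C y j k = - 1" "C y k j = - 1" using neg by simp_all
  qed
  define f g where "f = - C x j k" and "g = - C x k j"
  have fg: "C x j k = - f" "C x k j = - g" "1 \<le> f" "1 \<le> g"
    using C_neg[OF x_in I(2,3) jk(3) xjk0] by (simp_all add: f_def g_def)
  define m b where "m = - C x 1 j" and "b = - C x j 1"
  have mb: "C x 1 j = - m" "C x j 1 = - b" "C y 1 j = - m" "C y j 1 = - b"
    using y1j same[OF jk(1)] by (simp_all add: m_def b_def)
  have "1 \<le> m" "1 \<le> b" using C_neg[OF x_in I(1,2) d(1) adj] mb by simp_all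
  have mb2: "m * b = 2" using product mb by simp
  have zero_k1: "C x k 1 = 0" "C y k 1 = 0"
    using C_zero[OF x_in I(1,3) x1k] C_zero[OF y_in I(1,3) y1k] .
  \<comment> \<open>If \<open>g\<close> exceeded 1, the root \<open>s x k (alpha j)\<close>, moved
    to \<open>y\<close> and reflected at \<open>k\<close>, would have coordinates \<open>m\<close>,
    1 and \<open>1 - g\<close>.\<close>
  have g1: "g = 1"
  proof (rule ccontr)
    assume "g \<noteq> 1"
    have "vec3 1 j k 0 1 g \<in> R x"
      using fixed_root[OF jk(2) simple_root[OF x_in I(2)]] sigma_vec3(3)[OF x_in I, of 0 1 0] fg zero_k1
      by (simp add: alpha_vec3(2)[of j 1 k])
    then have "vec3 1 j k m 1 g \<in> R y"
      using moved_root[OF m1] sigma_vec3(1)[OF x_in I, of 0 1 g] mb x1k by force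
    then have "vec3 1 j k m 1 (1 - g) \<in> R y"
      using y.fixed_root[OF jk(2)] sigma_vec3(3)[OF y_in I, of m 1 g] yjk zero_k1 by force
    then have "0 \<le> 1 - g" using vec3_nonneg(1)[OF y_in _ d jk(3)] \<open>1 \<le> m\<close> by force
    then show False using fg(4) \<open>g \<noteq> 1\<close> by simp
  qed
  have "f \<noteq> 1" using ne fg yjk g1 by auto
  let ?p = "possum x 1" and ?p' = "possum y 1" and ?q = "possum x j" and ?r = "possum x k"
  have Py: "possum y l = possum x l" if "l \<noteq> 1" for l using possum_moved(1)[OF fin m1 that] .
  have e1: "2 + m * ?q \<le> ?p + ?p'"
    using possum_moved(2)[OF fin m1] row_le2[OF x_in fin I(1,2) d(1)] mb by simp
  have e2: "b * ?p + f * ?r \<le> 2 * ?q - 2"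
    using row_fixed[OF fin jk(1)] row_le3[OF x_in fin I(2,1,3)] d3 mb fg by auto
  have e3: "b * ?p' + ?r \<le> 2 * ?q - 2"
    using y.row_fixed[OF fy jk(1)] row_le3[OF y_in fy I(2,1,3)] d3 mb yjk Py[of j] Py[of k] by auto
  have e4: "?q \<le> 2 * ?r - 2"
    using row_fixed[OF fin jk(2)] row_le2[OF x_in fin I(3,2)] jk(3) fg g1 by auto
  \<comment> \<open>As \<open>m * b = 2\<close>, multiplying by \<open>b\<close> lets
    \<open>e2\<close> and \<open>e3\<close> eliminate \<open>?p\<close> and \<open>?p'\<close>.
    Combined with \<open>?q \<le> 2 * ?r - 2\<close> the result gives \<open>f + 1 < 4\<close>,
    while \<open>f = 1\<close> would make the two matrices agree on \<open>j\<close>,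
    \<open>k\<close>.\<close>
  have "b * (2 + m * ?q) \<le> b * (?p + ?p')" using e1 \<open>1 \<le> b\<close> by (intro mult_left_mono) auto
  moreover have "b * (m * ?q) = 2 * ?q" using mb2 by (simp add: mult.assoc[symmetric] mult.commute)
  ultimately have "2 * b + 2 * ?q \<le> b * ?p + b * ?p'" by (simp add: distrib_left)
  then have e5: "(f + 1) * ?r + 2 * b \<le> 2 * ?q - 4"
    using e2 e3 by (simp add: distrib_right)
  have r_pos: "1 \<le> ?r" using possum_pos[OF x_in fin I(3)] .
  have f2: "f = 2"
  proof (rule ccontr)
    assume "f \<noteq> 2"
    then have "3 \<le> f" using fg(3) \<open>f \<noteq> 1\<close> by simp
    then have "4 * ?r \<le> (f + 1) * ?r" using r_pos by (intro mult_right_mono) auto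
    then show False using e5 e4 \<open>1 \<le> b\<close> by simp
  qed
  have I_eq: "{1, j, k} = I"
  proof (rule isolated_block_total[OF fin irr])
    fix i l assume i: "i \<in> {1, j, k}" and "l \<in> I - {1, j, k}"
    then have l: "l \<in> I" "distinct [1, j, k, l]" "l \<in> {\<kappa><..\<theta>}" using one d3 by (auto simp: Iset_def)
    have x1l: "C x 1 l = 0" using unique[OF l(3)] l(2) by auto
    have y1l: "C y 1 l = 0" using x1l y1[OF l(1)] by simp
    have yjl: "C y j l = 0"
      using py.no_multiple_edge_at_branch[OF I l(1,2) mult1[OF jk(1) adj]] yjk by auto
    have xjl: "C x j l = 0"
      by (rule fixed_block_zero[OF m1 jk(1) l(3) _ adj x1l yjl]) (use l(2) in auto)
    \<comment> \<open>A neighbour \<open>l\<close> of \<open>k\<close> sharpens the bound on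
      \<open>?q\<close>: rows \<open>k\<close> and \<open>l\<close> give
      \<open>2 * ?q \<le> 3 * ?r - 6\<close>, against \<open>3 * ?r + 2 * b \<le> 2 * ?q - 4\<close>
      from \<open>e5\<close>.\<close>
    have xkl: "C x k l = 0"
    proof (rule ccontr)
      assume nz: "C x k l \<noteq> 0"
      have "k \<noteq> l" using l(2) by simp
      have neg: "C x k l \<le> - 1" "C x l k \<le> - 1" using C_neg[OF x_in I(3) l(1) \<open>k \<noteq> l\<close> nz] .
      let ?t = "possum x l"
      have "1 \<le> ?t" using possum_pos[OF x_in fin l(1)] .
      have "C x k l * ?t \<le> - 1 * ?t" using neg \<open>1 \<le> ?t\<close> by (intro mult_right_mono) auto
      moreover have "C x l k * ?r \<le> - 1 * ?r" using neg r_pos by (intro mult_right_mono) auto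
      moreover have "2 \<le> 2 * ?r + C x k j * ?q + C x k l * ?t"
        using row_fixed[OF fin jk(2)] row_le3[OF x_in fin I(3,2) l(1)] l(2) by auto
      moreover have "2 \<le> 2 * ?t + C x l k * ?r"
        using row_fixed[OF fin l(3)] row_le2[OF x_in fin l(1) I(3)] l(2) by auto
      ultimately show False using e5 f2 fg(2) g1 \<open>1 \<le> b\<close> by simp
    qed
    have ykl: "C y k l = 0"
      using fixed_block_eq[OF m1 jk(2) l(3) _ x1k x1l] l(2) xkl by auto
    show "C x i l = 0 \<and> C y i l = 0" using i x1l y1l yjl xjl xkl ykl by auto
  qed (use I in auto)
  have "card I = 3" unfolding I_eq[symmetric] using d3 by simp
  then have th: "\<theta> = 3" by (simp add: Iset_def)
  then have jk23: "j = 2 \<and> k = 3 \<or> j = 3 \<and> k = 2" using jk one by auto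
  \<comment> \<open>In the listed matrices the neighbour of 1 is called 2, so \<open>j = 3\<close>
    requires exchanging 2 and 3.\<close>
  define \<pi> where "\<pi> = (if j = 2 then id else transpose 2 (3::nat))"
  have \<pi>: "\<pi> permutes Iset \<theta>" "\<pi> ` {1..\<kappa>} = {1..\<kappa>}" "\<pi> 1 = 1" "\<pi> 2 = j" "\<pi> 3 = k"
    using jk23 one th by (auto simp: \<pi>_def permutes_id Iset_def intro!: permutes_swap_id)
  have zeros: "C x k 1 = 0" "C y k 1 = 0" "C x 1 k = 0" "C y 1 k = 0"
    using zero_k1 x1k y1k .
  note entries = mb fg(1,2) yjk zeros C_diag[OF x_in I(1)] C_diag[OF x_in I(2)] C_diag[OF x_in I(3)]
    C_diag[OF y_in I(1)] C_diag[OF y_in I(2)] C_diag[OF y_in I(3)]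
  have "m \<le> m * b" using \<open>1 \<le> m\<close> \<open>1 \<le> b\<close> by simp
  then have "m = 1 \<or> m = 2" using mb2 \<open>1 \<le> m\<close> by linarith
  then have "m = 1 \<and> b = 2 \<or> m = 2 \<and> b = 1" using mb2 by auto
  \<comment> \<open>The listed \<open>C^x\<close> is the matrix with simple edge, here the one at
    \<open>y\<close>, so the objects are exchanged. The pair \<open>(m, b)\<close> equals (1,2) in
    case (3) and (2,1) in case (4).\<close>
  then have "case3 \<theta> \<kappa> (\<lambda>i j. C y (\<pi> i) (\<pi> j)) (\<lambda>i j. C x (\<pi> i) (\<pi> j)) \<or>
      case4 \<theta> \<kappa> (\<lambda>i j. C y (\<pi> i) (\<pi> j)) (\<lambda>i j. C x (\<pi> i) (\<pi> j))"
    unfolding case3_def case4_def mat3_def \<pi>(3-5) entries f2 g1 using th one by auto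
  then show ?thesis
    unfolding classified_def Let_def using \<pi>(1,2) by (intro exI[of _ \<pi>] exI[of _ y] exI[of _ x]) simp
qed

text \<open>The inequality settles which object has positive rows: row 1 at \<open>y\<close> equals
  \<open>possum y 1 - possum x 1 + 2\<close>, and the other rows equal 2. The opposite inequality is
  treated by exchanging the objects.\<close>

lemma classified_if_one_moved:
  assumes fin: "finite (R x)" and irr: "irreducible_rs \<theta> {x, y} R" and one: "\<kappa> = 1"
    and le: "possum x 1 \<le> possum y 1"
  shows "classified \<theta> \<kappa> x y C"
proof -
  interpret y: two_objects \<theta> y x \<rho> C R \<kappa> by (rule swap)
  have fy: "finite (R y)" by (rule finite_both[OF fin])
  have m1: "1 \<in> {1..\<kappa>}" using one by simp
  have rows: "0 < row y i" if i: "i \<in> I" for i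
    using I_cases[OF i]
  proof
    assume "i \<in> {1..\<kappa>}"
    then have "i = 1" using one by simp
    then show ?thesis using y.possum_moved(2)[OF fy m1] le by simp
  next
    assume "i \<in> {\<kappa><..\<theta>}"
    then show ?thesis using y.row_fixed[OF fy] by simp
  qed
  \<comment> \<open>Row 1 agrees at both objects by (C2), so a difference lies in the first column
    or among the fixed indices.\<close>
  consider (mixed) j where "j \<in> {\<kappa><..\<theta>}" "C x j 1 \<noteq> C y j 1"
    | (block) j k where "\<And>j. j \<in> {\<kappa><..\<theta>} \<Longrightarrow> C x j 1 = C y j 1"
      "j \<in> {\<kappa><..\<theta>}" "k \<in> {\<kappa><..\<theta>}" "C x j k \<noteq> C y j k"
    | (equal) "\<And>i j. i \<in> I \<Longrightarrow> j \<in> I \<Longrightarrow> C x i j = C y i j"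
  proof -
    have "C x i j = C y i j" if "i \<in> I" "j \<in> I" "\<forall>j\<in>{\<kappa><..\<theta>}. C x j 1 = C y j 1"
      "\<forall>j\<in>{\<kappa><..\<theta>}. \<forall>k\<in>{\<kappa><..\<theta>}. C x j k = C y j k" for i j
      using I_cases[OF that(1)] I_cases[OF that(2)] that row_moved[of i j] one by auto
    then show ?thesis using mixed block equal by metis
  qed
  then show ?thesis
  proof cases
    case mixed
    then show ?thesis using case2_if_mixed_differs[OF fin irr one rows] classified_id by blast
  next
    case block
    have d: "j \<noteq> k" using block(2,4) C_diag[OF x_in] C_diag[OF y_in] in_I(2) by metis
    have "C x 1 j \<noteq> 0 \<or> C x 1 k \<noteq> 0" using fixed_block_eq[OF m1 block(2,3) d] block(4) by blast
    then show ?thesis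
      using classified_if_fixed_block_differs[OF fin irr one rows block(1) block(2,3) d]
        classified_if_fixed_block_differs[OF fin irr one rows block(1) block(3,2) d[symmetric]] block(4)
      by blast
  next
    case equal
    then show ?thesis using case1_if_equal[OF fin irr] classified_id by blast
  qed
qed

lemma classified_swap: "classified \<theta> \<kappa> y x C \<Longrightarrow> classified \<theta> \<kappa> x y C"
  unfolding classified_def by (simp add: insert_commute disj_commute)

lemma classified_if_finite_irreducible:
  assumes fin: "finite (R x)" and irr: "irreducible_rs \<theta> {x, y} R"
  shows "classified \<theta> \<kappa> x y C"
proof (cases "\<kappa> = 1")
  case True
  interpret y: two_objects \<theta> y x \<rho> C R \<kappa> by (rule swap)
  have irr': "irreducible_rs \<theta> {y, x} R" using irr by (simp add: insert_commute)
  show ?thesis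
    using classified_if_one_moved[OF fin irr True]
      classified_swap[OF y.classified_if_one_moved[OF finite_both[OF fin] irr' True]]
    by linarith
next
  case False
  then have "2 \<le> \<kappa>" using kappa by auto
  then show ?thesis
    using case1_if_equal[OF fin irr equal_if_two_moved[OF fin]] classified_id by blast
qed

end

section \<open>The converse\<close>

lemma indecomposable_if_chain:
  assumes chain: "\<And>i. 1 \<le> i \<Longrightarrow> i < \<theta> \<Longrightarrow> M i (Suc i) \<noteq> 0"
  shows "indecomposable \<theta> M"
  unfolding indecomposable_def
proof clarify
  fix I1 I2 assume ne: "I1 \<noteq> {}" "I2 \<noteq> {}" and part: "I1 \<inter> I2 = {}" "I1 \<union> I2 = Iset \<theta>"
    and zero: "\<forall>i\<in>I1. \<forall>j\<in>I2. M i j = 0 \<and> M j i = 0"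
  have same: "i \<le> \<theta> \<Longrightarrow> i \<in> I1 \<longleftrightarrow> 1 \<in> I1" if "1 \<le> i" for i
    using that
  proof (induction i rule: dec_induct)
    case (step i)
    then have "i \<in> I1 \<union> I2" "Suc i \<in> I1 \<union> I2" unfolding part(2) by (auto simp: Iset_def)
    moreover have "M i (Suc i) \<noteq> 0" using chain step by simp
    ultimately have "i \<in> I1 \<longleftrightarrow> Suc i \<in> I1" using zero part(1) by blast
    then show ?case using step by simp
  qed simp
  obtain i j where "i \<in> I1" "j \<in> I2" using ne by blast
  moreover have "i \<in> Iset \<theta>" "j \<in> Iset \<theta>" using part(2) calculation by blast+
  ultimately show False using same[of i] same[of j] part(1) by (auto simp: Iset_def)
qed

lemma indecomposable_cases:
  assumes "case1 \<theta> \<kappa> Cx Cy \<or> case2 \<theta> \<kappa> Cx Cy \<or> case3 \<theta> \<kappa> Cx Cy \<or> case4 \<theta> \<kappa> Cx Cy"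
  shows "indecomposable \<theta> Cx"
proof (cases "case1 \<theta> \<kappa> Cx Cy")
  case True
  then show ?thesis by (simp add: case1_def)
next
  case False
  then have c: "case2 \<theta> \<kappa> Cx Cy \<or> case3 \<theta> \<kappa> Cx Cy \<or> case4 \<theta> \<kappa> Cx Cy"
    using assms by blast
  show ?thesis
  proof (rule indecomposable_if_chain)
    fix i assume "1 \<le> i" "i < \<theta>"
    moreover from this have "i = 1 \<or> i = 2"
      using c unfolding case2_def case3_def case4_def by linarith
    ultimately show "Cx i (Suc i) \<noteq> 0"
      using c by (auto simp: case2_def case3_def case4_def mat3_def numeral_2_eq_2 numeral_3_eq_3)
  qed
qed

context two_objects
begin

lemma irreducible_if_indecomposable:
  assumes \<pi>: "\<pi> permutes I" and ind: "indecomposable \<theta> (\<lambda>i j. C x (\<pi> i) (\<pi> j))"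
  shows "irreducible_rs \<theta> {x, y} R"
proof (rule ccontr)
  assume "\<not> ?thesis"
  then have "reducible_rs \<theta> {x, y} R" by (simp add: irreducible_rs_def)
  then show False
  proof (rule reducible_imp_decomposable)
    fix I1 I2 assume I12: "I1 \<noteq> {}" "I2 \<noteq> {}" "I1 \<inter> I2 = {}" "I1 \<union> I2 = I"
      and zero: "\<And>a i j. a \<in> {x, y} \<Longrightarrow> i \<in> I1 \<Longrightarrow> j \<in> I2 \<Longrightarrow> C a i j = 0 \<and> C a j i = 0"
    have zero': "\<forall>i\<in>\<pi> -` I1. \<forall>j\<in>\<pi> -` I2. C x (\<pi> i) (\<pi> j) = 0 \<and> C x (\<pi> j) (\<pi> i) = 0"
      using zero[OF x_in] by blast
    have "\<pi> -` I1 \<union> \<pi> -` I2 = I"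
      using permutes_vimage[OF \<pi>] I12(4) by (metis vimage_Un)
    then have "\<pi> -` I1 = {} \<or> \<pi> -` I2 = {}"
      by (intro indecomposableD[OF ind _ _ zero']) (use I12(3) in auto)
    then show False using I12(1,2) permutes_surj[OF \<pi>] by (metis surj_image_vimage_eq image_empty)
  qed
qed

lemma finite_case1:
  assumes \<pi>: "\<pi> permutes I" and c: "case1 \<theta> \<kappa> (\<lambda>i j. C x (\<pi> i) (\<pi> j)) (\<lambda>i j. C y (\<pi> i) (\<pi> j))"
  shows "finite (R x)"
proof -
  let ?\<sigma> = "inv_into UNIV \<pi>"
  have \<sigma>: "?\<sigma> permutes I" using permutes_inv[OF \<pi>] .
  have in\<sigma>: "?\<sigma> i \<in> I" if "i \<in> I" for i using that permutes_in_image[OF \<sigma>] by simp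
  have \<pi>\<sigma>: "\<pi> (?\<sigma> i) = i" for i using permutes_inverses(1)[OF \<pi>] .
  obtain u where u: "\<forall>i\<in>I. 0 < u i" "\<forall>i\<in>I. 0 < matvec \<theta> (\<lambda>i j. C x (\<pi> i) (\<pi> j)) u i"
    using c unfolding case1_def cartan_finite_type_def finite_type_def by blast
  have "C a i j = C x i j" if "a \<in> {x, y}" "i \<in> I" "j \<in> I" for a i j
  proof -
    have "C x (\<pi> (?\<sigma> i)) (\<pi> (?\<sigma> j)) = C y (\<pi> (?\<sigma> i)) (\<pi> (?\<sigma> j))"
      using c in\<sigma>[OF that(2)] in\<sigma>[OF that(3)] unfolding case1_def by blast
    then show ?thesis using that(1) unfolding \<pi>\<sigma> by auto
  qed
  moreover have "\<forall>i\<in>I. 0 < u (?\<sigma> i)" using u(1) in\<sigma> by blast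
  moreover have "\<forall>i\<in>I. 0 < matvec \<theta> (C x) (\<lambda>i. u (?\<sigma> i)) i"
  proof
    fix i assume i: "i \<in> I"
    have "matvec \<theta> (C x) (\<lambda>i. u (?\<sigma> i)) i = (\<Sum>j\<in>I. C x i j * u (?\<sigma> j))" by (simp add: matvec_def)
    also have "\<dots> = (\<Sum>j\<in>I. C x i (\<pi> j) * u (?\<sigma> (\<pi> j)))"
      by (rule sum.permute[OF \<pi>, unfolded comp_def])
    also have "\<dots> = matvec \<theta> (\<lambda>i j. C x (\<pi> i) (\<pi> j)) u (?\<sigma> i)"
      by (simp add: matvec_def \<pi>\<sigma> permutes_inverses(2)[OF \<pi>])
    also have "0 < \<dots>" using u(2) in\<sigma>[OF i] by blast
    finally show "0 < matvec \<theta> (C x) (\<lambda>i. u (?\<sigma> i)) i" .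
  qed
  ultimately show ?thesis by (rule finite_if_common_matrix[OF _ _ _ x_in])
qed

section \<open>Explicit words for the exceptional matrices\<close>

text \<open>The alternating word returns to \<open>x\<close>, as \<open>i\<close> occurs an even
  number of times, and acts there as minus the identity. Its length, 8 for -4 and 12 for -5, bounds
  the number of positive roots at \<open>x\<close>.\<close>

lemma finite_case2:
  assumes i: "i \<in> {1..\<kappa>}" and j: "j \<in> {\<kappa><..\<theta>}" and I_eq: "I = {i, j}"
    and C: "C x i j = - 1" "C x j i = - 3" "C y j i = - 4 \<or> C y j i = - 5"
  shows "finite (R x)"
proof -
  have I: "i \<in> I" "j \<in> I" using in_I i j by blast+
  have yij: "C y i j = - 1" using row_moved[OF i I(2)] C(1) by simp
  define V where "V p q = (\<lambda>k. p * alpha i k + q * alpha j k)" for p q :: int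
  obtain c where c: "C y j i = - c" "c = 4 \<or> c = 5" using C(3) by force
  have s: "s x i (V p q) = V (q - p) q" "s x j (V p q) = V p (3 * p - q)"
      "s y i (V p q) = V (q - p) q" "s y j (V p q) = V p (c * p - q)" for p q
    using sigma_vec3[OF x_in I(1,2,1), of p q 0] sigma_vec3[OF y_in I(1,2,1), of p q 0] C yij c(1)
    by (simp_all add: vec3_def V_def)
  have \<rho>: "\<rho> i x = y" "\<rho> i y = x" "\<rho> j x = x" "\<rho> j y = y" using moved fixed i j by auto
  have V: "alpha i = V 1 0" "alpha j = V 0 1" by (simp_all add: V_def)
  have neg: "V (- 1) 0 k \<le> 0" "V 0 (- 1) k \<le> 0" for k by (simp_all add: V_def alpha_nonneg)
  define w where "w = (if c = 4 then [i, j, i, j, i, j, i, j] else [i, j, i, j, i, j, i, j, i, j, i, j])"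
  show ?thesis
  proof (rule finite_if_longest_word[OF x_in])
    show "set w \<subseteq> I" using I by (simp add: w_def)
    fix l k assume "l \<in> I"
    then have "l = i \<or> l = j" using I_eq by blast
    moreover have "act x w (V 1 0) = V (- 1) 0" "act x w (V 0 1) = V 0 (- 1)"
      using c(2) by (auto simp: w_def s \<rho>)
    ultimately show "act x w (alpha l) k \<le> 0" using V neg by auto
  qed
qed

text \<open>One word of length 13 negates all simple roots for both choices of \<open>m\<close> and
  \<open>b\<close>. It contains \<open>i\<close> four times and so ends at \<open>x\<close> again;
  at most 13 roots at \<open>x\<close> are positive.\<close>

lemma finite_case34:
  assumes i: "i \<in> {1..\<kappa>}" and j: "j \<in> {\<kappa><..\<theta>}" and k: "k \<in> {\<kappa><..\<theta>}" and I_eq: "I = {i, j, k}"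
    and C: "C x i j = - m" "C x j i = - b" "C y j i = - b" "C x i k = 0"
      "C x j k = - 1" "C x k j = - 1" "C y j k = - 2" "C y k j = - 1"
    and mb: "m = 1 \<and> b = 2 \<or> m = 2 \<and> b = 1"
  shows "finite (R x)"
proof -
  have I: "i \<in> I" "j \<in> I" "k \<in> I" using in_I i j k by blast+
  have y: "C y i j = - m" "C y i k = 0" using row_moved[OF i] I C by metis+
  have z: "C x k i = 0" "C y k i = 0"
    using C_zero[OF x_in I(1,3)] C_zero[OF y_in I(1,3)] y C by simp_all
  have s: "s x i (vec3 i j k p q r) = vec3 i j k (m * q - p) q r"
      "s x j (vec3 i j k p q r) = vec3 i j k p (b * p + r - q) r"
      "s x k (vec3 i j k p q r) = vec3 i j k p q (q - r)"
      "s y i (vec3 i j k p q r) = vec3 i j k (m * q - p) q r"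
      "s y j (vec3 i j k p q r) = vec3 i j k p (b * p + 2 * r - q) r"
      "s y k (vec3 i j k p q r) = vec3 i j k p q (q - r)" for p q r
    using sigma_vec3[OF x_in I, of p q r] sigma_vec3[OF y_in I, of p q r] C y z
    by (simp_all add: algebra_simps)
  have \<rho>: "\<rho> i x = y" "\<rho> i y = x" "\<rho> j x = x" "\<rho> j y = y" "\<rho> k x = x" "\<rho> k y = y"
    using moved fixed i j k by auto
  have neg: "vec3 i j k (- 1) 0 0 l \<le> 0" "vec3 i j k 0 (- 1) 0 l \<le> 0" "vec3 i j k 0 0 (- 1) l \<le> 0" for l
    by (simp_all add: vec3_def alpha_nonneg)
  let ?w = "[i, j, i, j, k, j, i, j, k, j, i, j, k]"
  show ?thesis
  proof (rule finite_if_longest_word[OF x_in])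
    show "set ?w \<subseteq> I" using I by simp
    fix n l assume "n \<in> I"
    then have "n = i \<or> n = j \<or> n = k" using I_eq by blast
    moreover have "act x ?w (vec3 i j k 1 0 0) = vec3 i j k (- 1) 0 0"
      "act x ?w (vec3 i j k 0 1 0) = vec3 i j k 0 (- 1) 0"
      "act x ?w (vec3 i j k 0 0 1) = vec3 i j k 0 0 (- 1)"
      using mb by (auto simp: s \<rho>)
    ultimately show "act x ?w (alpha n) l \<le> 0"
      using alpha_vec3[where i = i and j = j and k = k] neg by auto
  qed
qed

lemma finite_irreducible_cases:
  assumes \<pi>: "\<pi> permutes I" "\<pi> ` {1..\<kappa>} = {1..\<kappa>}"
    and c: "case1 \<theta> \<kappa> (\<lambda>i j. C x (\<pi> i) (\<pi> j)) (\<lambda>i j. C y (\<pi> i) (\<pi> j))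
      \<or> case2 \<theta> \<kappa> (\<lambda>i j. C x (\<pi> i) (\<pi> j)) (\<lambda>i j. C y (\<pi> i) (\<pi> j))
      \<or> case3 \<theta> \<kappa> (\<lambda>i j. C x (\<pi> i) (\<pi> j)) (\<lambda>i j. C y (\<pi> i) (\<pi> j))
      \<or> case4 \<theta> \<kappa> (\<lambda>i j. C x (\<pi> i) (\<pi> j)) (\<lambda>i j. C y (\<pi> i) (\<pi> j))"
  shows "finite (R x) \<and> irreducible_rs \<theta> {x, y} R"
proof
  show "irreducible_rs \<theta> {x, y} R"
    using irreducible_if_indecomposable[OF \<pi>(1) indecomposable_cases[OF c]] .
  have img: "\<pi> ` I = I" using permutes_image[OF \<pi>(1)] .
  have fixed_block: "\<pi> l \<in> {\<kappa><..\<theta>}" if l: "l \<in> {\<kappa><..\<theta>}" for l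
  proof -
    have "\<pi> l \<notin> \<pi> ` {1..\<kappa>}" using l by (simp add: inj_image_mem_iff[OF permutes_inj[OF \<pi>(1)]])
    moreover have "\<pi> l \<in> I" using in_I(2)[OF l] permutes_in_image[OF \<pi>(1)] by blast
    ultimately show ?thesis using I_cases unfolding \<pi>(2) by blast
  qed
  have "\<pi> 1 \<in> \<pi> ` {1..\<kappa>}" using kappa by (intro imageI) simp
  then have 1: "\<pi> 1 \<in> {1..\<kappa>}" unfolding \<pi>(2) .
  show "finite (R x)"
    using c
  proof (elim disjE)
    assume "case1 \<theta> \<kappa> (\<lambda>i j. C x (\<pi> i) (\<pi> j)) (\<lambda>i j. C y (\<pi> i) (\<pi> j))"
    then show ?thesis by (rule finite_case1[OF \<pi>(1)])
  next
    assume c: "case2 \<theta> \<kappa> (\<lambda>i j. C x (\<pi> i) (\<pi> j)) (\<lambda>i j. C y (\<pi> i) (\<pi> j))"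
    then have "I = {1, 2}" by (auto simp: case2_def Iset_def)
    then have "\<pi> ` I = \<pi> ` {1, 2}" by (rule arg_cong)
    then have I_eq: "I = {\<pi> 1, \<pi> 2}" by (simp only: img image_insert image_empty)
    have "\<pi> 2 \<in> {\<kappa><..\<theta>}"
      by (rule fixed_block) (use c in \<open>simp add: case2_def\<close>)
    then show ?thesis
      by (rule finite_case2[OF 1 _ I_eq]) (use c in \<open>simp_all add: case2_def\<close>)
  next
    assume c: "case3 \<theta> \<kappa> (\<lambda>i j. C x (\<pi> i) (\<pi> j)) (\<lambda>i j. C y (\<pi> i) (\<pi> j))"
    then have "I = {1, 2, 3}" by (auto simp: case3_def Iset_def)
    then have "\<pi> ` I = \<pi> ` {1, 2, 3}" by (rule arg_cong)
    then have I_eq: "I = {\<pi> 1, \<pi> 2, \<pi> 3}" by (simp only: img image_insert image_empty)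
    have "\<pi> 2 \<in> {\<kappa><..\<theta>}" "\<pi> 3 \<in> {\<kappa><..\<theta>}"
      by (rule fixed_block; use c in \<open>simp add: case3_def\<close>)+
    then show ?thesis
      by (rule finite_case34[OF 1 _ _ I_eq, of 1 2]) (use c in \<open>simp_all add: case3_def mat3_def\<close>)
  next
    assume c: "case4 \<theta> \<kappa> (\<lambda>i j. C x (\<pi> i) (\<pi> j)) (\<lambda>i j. C y (\<pi> i) (\<pi> j))"
    then have "I = {1, 2, 3}" by (auto simp: case4_def Iset_def)
    then have "\<pi> ` I = \<pi> ` {1, 2, 3}" by (rule arg_cong)
    then have I_eq: "I = {\<pi> 1, \<pi> 2, \<pi> 3}" by (simp only: img image_insert image_empty)
    have "\<pi> 2 \<in> {\<kappa><..\<theta>}" "\<pi> 3 \<in> {\<kappa><..\<theta>}"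
      by (rule fixed_block; use c in \<open>simp add: case4_def\<close>)+
    then show ?thesis
      by (rule finite_case34[OF 1 _ _ I_eq, of 2 1]) (use c in \<open>simp_all add: case4_def mat3_def\<close>)
  qed
qed

lemma finite_irreducible_if_classified:
  assumes "classified \<theta> \<kappa> x y C"
  shows "finite (R x) \<and> irreducible_rs \<theta> {x, y} R"
proof -
  interpret y: two_objects \<theta> y x \<rho> C R \<kappa> by (rule swap)
  obtain \<pi> x0 y0 where \<pi>: "\<pi> permutes I" "\<pi> ` {1..\<kappa>} = {1..\<kappa>}" and xy0: "(x0, y0) \<in> {(x, y), (y, x)}"
    and c: "case1 \<theta> \<kappa> (\<lambda>i j. C x0 (\<pi> i) (\<pi> j)) (\<lambda>i j. C y0 (\<pi> i) (\<pi> j))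
      \<or> case2 \<theta> \<kappa> (\<lambda>i j. C x0 (\<pi> i) (\<pi> j)) (\<lambda>i j. C y0 (\<pi> i) (\<pi> j))
      \<or> case3 \<theta> \<kappa> (\<lambda>i j. C x0 (\<pi> i) (\<pi> j)) (\<lambda>i j. C y0 (\<pi> i) (\<pi> j))
      \<or> case4 \<theta> \<kappa> (\<lambda>i j. C x0 (\<pi> i) (\<pi> j)) (\<lambda>i j. C y0 (\<pi> i) (\<pi> j))"
    using assms unfolding classified_def Let_def by blast
  from xy0 consider "x0 = x" "y0 = y" | "x0 = y" "y0 = x" by auto
  then show ?thesis
  proof cases
    case 1
    then show ?thesis using finite_irreducible_cases[OF \<pi>] c by simp
  next
    case 2
    then show ?thesis
      using y.finite_irreducible_cases[OF \<pi>] c y.finite_both by (simp add: insert_commute)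
  qed
qed

end

theorem theorem5p4:
  fixes \<theta> \<kappa> :: nat and x y :: 'a and \<rho> :: "nat \<Rightarrow> 'a \<Rightarrow> 'a"
    and C :: "'a \<Rightarrow> nat \<Rightarrow> nat \<Rightarrow> int" and R :: "'a \<Rightarrow> (nat \<Rightarrow> int) set"
  assumes "1 \<le> \<theta>"
    and "x \<noteq> y"
    and "cartan_scheme \<theta> {x, y} \<rho> C"
    and "connected_scheme \<theta> {x, y} \<rho>"
    and "root_system \<theta> {x, y} \<rho> C R"
    and "\<kappa> \<in> {1..\<theta>}"
    and "\<forall>i\<in>{1..\<kappa>}. \<rho> i x = y \<and> \<rho> i y = x"
    and "\<forall>i\<in>{\<kappa><..\<theta>}. \<rho> i x = x \<and> \<rho> i y = y"
  shows "(finite_rs {x, y} R \<and> irreducible_rs \<theta> {x, y} R) \<longleftrightarrow> classified \<theta> \<kappa> x y C"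
proof -
  interpret two_objects \<theta> x y \<rho> C R \<kappa>
    by unfold_locales (use assms in auto)
  show ?thesis
    using classified_if_finite_irreducible finite_irreducible_if_classified finite_both
    by (auto simp: finite_rs_def)
qed

end
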